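(* Let $n\ge 4$ and let $G$ be a unicyclic graph on $n$ vertices. Then $ER(G)\le ER(X_n)$, with equality if and only if $G\cong X_n$. Moreover, if $G$ is bipartite, then $ER(G)\le ER(\tilde{X}_n)$, with equality if and only if $G\cong \tilde{X}_n$.
   Context: All graphs are finite, simple and undirected. For a graph $G$ on $n$ vertices with adjacency eigenvalues $\lambda_1\ge\lambda_2\ge\cdots\ge\lambda_n$, the resolvent energy is $ER(G)=\sum_{i=1}^n \frac{1}{n-\lambda_i}$. A unicyclic graph is a connected graph with $n$ vertices and $n$ edges. $X_n$ denotes the unicyclic graph obtained from the cycle $C_3$ by attaching $n-3$ pendent vertices to one of its vertices; $\tilde{X}_n$ denotes the unicyclic graph obtained from the cycle $C_4$ by attaching $n-4$ pendent vertices to one of its vertices. *)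

theory Defs
  imports "Graph_Theory.Graph_Theory" "Jordan_Normal_Form.Char_Poly"
begin

(* A finite simple undirected graph is a pair_graph: its arc set parcs is symmetric and
   irreflexive, so every undirected edge {u, v} is represented by the two arcs (u, v), (v, u). *)

definition uedges :: "'a pair_pre_digraph \<Rightarrow> 'a set set" where
  "uedges G = {{u, v} | u v. (u, v) \<in> parcs G}"

definition unicyclic :: "'a pair_pre_digraph \<Rightarrow> bool" where
  "unicyclic G \<longleftrightarrow>
     pair_graph G \<and> Digraph_Component.connected (with_proj G) \<and> card (uedges G) = card (pverts G)"

definition bipartite :: "'a pair_pre_digraph \<Rightarrow> bool" where
  "bipartite G \<longleftrightarrow>
     (\<exists>A B. pverts G = A \<union> B \<and> A \<inter> B = {} \<and> parcs G \<subseteq> A \<times> B \<union> B \<times> A)"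

definition adj_mat_wrt :: "(nat \<Rightarrow> 'a) \<Rightarrow> 'a pair_pre_digraph \<Rightarrow> real mat" where
  "adj_mat_wrt f G = mat (card (pverts G)) (card (pverts G))
     (\<lambda>(i, j). if (f i, f j) \<in> parcs G then 1 else 0)"

(* from_nat_into (pverts G) restricts to a bijection from {..<card (pverts G)} to a finite
   vertex set; the spectrum does not depend on this choice, see char_poly_adj_mat_wrt. *)
definition adj_mat :: "'a pair_pre_digraph \<Rightarrow> real mat" where
  "adj_mat G = adj_mat_wrt (from_nat_into (pverts G)) G"

(* The real roots of the characteristic polynomial with multiplicity; as the adjacency matrix
   is symmetric these are all n eigenvalues, see size_adj_eigenvalues. *)
definition adj_eigenvalues :: "'a pair_pre_digraph \<Rightarrow> real multiset" where
  "adj_eigenvalues G = proots (char_poly (adj_mat G))"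

lemma det_permute_both:
  fixes A :: "'a :: comm_ring_1 mat"
  assumes A: "A \<in> carrier_mat n n" and p: "p permutes {0..<n}"
  shows "det (mat n n (\<lambda>(i, j). A $$ (p i, p j))) = det A"
proof -
  define C where "C = mat n n (\<lambda>(i, j). A $$ (p i, j))"
  have C: "C \<in> carrier_mat n n" by (simp add: C_def)
  have pl: "p i < n" if "i < n" for i
    using permutes_in_image[OF p, of i] that by simp
  have "mat n n (\<lambda>(i, j). A $$ (p i, p j)) =
      transpose_mat (mat n n (\<lambda>(i, j). transpose_mat C $$ (p i, j)))"
    by (rule eq_matI) (auto simp: C_def pl)
  then have "det (mat n n (\<lambda>(i, j). A $$ (p i, p j))) =
      det (mat n n (\<lambda>(i, j). transpose_mat C $$ (p i, j)))"
    using det_transpose[of "mat n n (\<lambda>(i, j). transpose_mat C $$ (p i, j))" n] by simp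
  also have "\<dots> = signof p * det C"
    using det_permute_rows[of "transpose_mat C" n p] C p by (simp add: det_transpose[OF C])
  also have "\<dots> = (signof p * signof p) * det A"
    using det_permute_rows[OF A p] by (simp add: C_def mult.assoc)
  also have "signof p * signof p = (1 :: 'a)"
    by (simp add: sign_def)
  finally show ?thesis by simp
qed

lemma char_poly_adj_mat_wrt:
  assumes fin: "finite (pverts G)" and f: "bij_betw f {..<card (pverts G)} (pverts G)"
  shows "char_poly (adj_mat_wrt f G) = char_poly (adj_mat G)"
proof -
  define n where "n = card (pverts G)"
  define g where "g = from_nat_into (pverts G)"
  have g: "bij_betw g {..<n} (pverts G)"
    unfolding g_def n_def by (rule bij_betw_from_nat_into_finite[OF fin])
  have f: "bij_betw f {..<n} (pverts G)" using f by (simp add: n_def)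
  define q where "q = inv_into {..<n} g \<circ> f"
  define p where "p i = (if i < n then q i else i)" for i
  have "bij_betw q {..<n} {..<n}"
    unfolding q_def by (rule bij_betw_trans[OF f bij_betw_inv_into[OF g]])
  then have "bij_betw p {..<n} {..<n}"
    by (subst bij_betw_cong[of _ _ q]) (auto simp: p_def)
  then have p: "p permutes {0..<n}"
    unfolding lessThan_atLeast0 by (rule bij_imp_permutes) (auto simp: p_def)
  have pl: "p i < n" if "i < n" for i
    using permutes_in_image[OF p, of i] that by simp
  have inj: "p i = p j \<longleftrightarrow> i = j" for i j
    using permutes_inj[OF p] by (auto dest: injD)
  have gp: "g (p i) = f i" if "i < n" for i
  proof -
    have "f i \<in> g ` {..<n}"
      using f g that by (auto simp: bij_betw_def)
    then show ?thesis using that by (simp add: p_def q_def f_inv_into_f)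
  qed
  let ?A = "char_poly_matrix (adj_mat G)"
  have A: "?A \<in> carrier_mat n n"
    by (auto simp: char_poly_matrix_def adj_mat_def adj_mat_wrt_def n_def)
  have "char_poly_matrix (adj_mat_wrt f G) = mat n n (\<lambda>(i, j). ?A $$ (p i, p j))"
    by (rule eq_matI)
       (auto simp: char_poly_matrix_def adj_mat_def adj_mat_wrt_def pl gp inj
             simp flip: n_def g_def)
  then show ?thesis
    using det_permute_both[OF A p] by (simp add: char_poly_def)
qed

lemma size_proots_real_rooted:
  fixes p :: "real poly"
  assumes "p \<noteq> 0" and "\<And>z. poly (map_poly complex_of_real p) z = 0 \<Longrightarrow> z \<in> \<real>"
  shows "size (proots p) = degree p"
  using assms
proof (induction "degree p" arbitrary: p)
  case 0
  then show ?case using size_proots_le[of p] by simp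
next
  case (Suc d)
  let ?c = "map_poly complex_of_real"
  have "degree (?c p) = Suc d" using Suc.hyps(2) by simp
  then obtain z where z: "poly (?c p) z = 0"
    using fundamental_theorem_of_algebra[of "?c p"] constant_degree[of "?c p"] by auto
  then obtain r where r: "z = of_real r" using Suc.prems(2) by (auto elim: Reals_cases)
  with z have "poly p r = 0" by simp
  then obtain q where q: "p = [:-r, 1:] * q" by (auto simp: poly_eq_0_iff_dvd elim: dvdE)
  with Suc.prems(1) have q0: "q \<noteq> 0" by auto
  have deg: "degree p = Suc (degree q)"
    unfolding q using q0 by (subst degree_mult_eq) auto
  have "size (proots q) = degree q"
  proof (rule Suc.hyps(1))
    show "d = degree q" using deg Suc.hyps(2) by simp
    show "z \<in> \<real>" if "poly (?c q) z = 0" for z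
    proof -
      interpret map_poly_comm_ring_hom complex_of_real ..
      show ?thesis
        by (rule Suc.prems(2)) (simp only: q hom_mult poly_mult that mult_zero_right)
    qed
  qed (fact q0)
  moreover have "proots p = proots [:-r, 1:] + proots q"
    unfolding q using q0 by (intro proots_mult) auto
  ultimately show ?case by (simp add: deg)
qed

lemma size_adj_eigenvalues:
  assumes "pair_graph G"
  shows "size (adj_eigenvalues G) = card (pverts G)"
proof -
  define n where "n = card (pverts G)"
  define A where "A = adj_mat G"
  define C where "C = map_mat complex_of_real A"
  have A: "A \<in> carrier_mat n n"
    by (simp add: A_def adj_mat_def adj_mat_wrt_def n_def)
  have C: "C \<in> carrier_mat n n" using A by (simp add: C_def)
  interpret pair_graph G by fact
  have "sym (parcs G)" using pair_sym_arcs by (simp add: symmetric_def)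
  then have symC: "transpose_mat C = C"
    by (intro eq_matI) (auto simp: C_def A_def adj_mat_def adj_mat_wrt_def dest: symD)
  have "z \<in> \<real>" if "poly (map_poly complex_of_real (char_poly A)) z = 0" for z
  proof -
    have "poly (char_poly C) z = 0"
      using that by (simp add: C_def of_real_hom.char_poly_hom[OF A])
    then obtain v where "eigenvector C v z"
      unfolding eigenvalue_root_char_poly[OF C, symmetric] eigenvalue_def by blast
    then have v: "v \<in> carrier_vec n" and v0: "v \<noteq> 0\<^sub>v n" and ev: "C *\<^sub>v v = z \<cdot>\<^sub>v v"
      using C by (auto simp: eigenvector_def)
    have cv: "conjugate v \<in> carrier_vec n" using v by simp
    have "conjugate (C *\<^sub>v v) = C *\<^sub>v conjugate v"
    proof (rule eq_vecI)
      fix i assume "i < dim_vec (C *\<^sub>v conjugate v)"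
      then have i: "i < n" using C by simp
      have "conjugate (C *\<^sub>v v) $ i = cnj (\<Sum>j = 0..<n. C $$ (i, j) * v $ j)"
        using i C v by (simp add: scalar_prod_def)
      also have "\<dots> = (\<Sum>j = 0..<n. C $$ (i, j) * cnj (v $ j))"
        using i A by (simp add: C_def)
      also have "\<dots> = (C *\<^sub>v conjugate v) $ i"
        using i C v by (simp add: scalar_prod_def)
      finally show "conjugate (C *\<^sub>v v) $ i = (C *\<^sub>v conjugate v) $ i" .
    qed (use C in simp)
    then have ev': "C *\<^sub>v conjugate v = cnj z \<cdot>\<^sub>v conjugate v"
      by (simp add: ev conjugate_smult_vec)
    have "z * (v \<bullet>c v) = (C *\<^sub>v v) \<bullet> conjugate v"
      using v cv by (simp add: ev)
    also have "\<dots> = v \<bullet> (C *\<^sub>v conjugate v)"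
      using transpose_vec_mult_scalar[OF C cv v] v cv C
      by (metis (no_types) symC comm_scalar_prod mult_mat_vec_carrier)
    also have "\<dots> = cnj z * (v \<bullet>c v)"
      using v cv by (simp add: ev')
    finally have "z = cnj z"
      using conjugate_square_eq_0_vec[OF v] v0 by simp
    then show ?thesis by (simp add: Reals_cnj_iff)
  qed
  moreover have "char_poly A \<noteq> 0" and "degree (char_poly A) = n"
    using degree_monic_char_poly[OF A] by auto
  ultimately show ?thesis
    using size_proots_real_rooted[of "char_poly A"]
    by (simp add: adj_eigenvalues_def A_def n_def)
qed

definition resolvent_energy :: "'a pair_pre_digraph \<Rightarrow> real" where
  "resolvent_energy G = (\<Sum>x\<in>#adj_eigenvalues G. 1 / (real (card (pverts G)) - x))"

(* The cycle 0, 1, ..., k-1 with the pendent vertices k, ..., n-1 attached to 0. *)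
definition cycle_pendants :: "nat \<Rightarrow> nat \<Rightarrow> nat pair_pre_digraph" where
  "cycle_pendants k n =
     (let E = {(i, Suc i mod k) | i. i < k} \<union> {(0, j) | j. k \<le> j \<and> j < n}
      in \<lparr>pverts = {..<n}, parcs = E \<union> E\<inverse>\<rparr>)"

lemma pair_graph_cycle_pendants:
  assumes "2 \<le> k" and "k \<le> n"
  shows "pair_graph (cycle_pendants k n)"
proof -
  define E where "E = {(i, Suc i mod k) | i. i < k} \<union> {(0 :: nat, j) | j. k \<le> j \<and> j < n}"
  have G: "cycle_pendants k n = \<lparr>pverts = {..<n}, parcs = E \<union> E\<inverse>\<rparr>"
    by (simp add: cycle_pendants_def E_def Let_def)
  have sub: "E \<subseteq> {..<n} \<times> {..<n}"
    using assms by (auto simp: E_def intro: less_le_trans[OF mod_less_divisor])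
  have irr: "(i, i) \<notin> E" for i
  proof (cases "Suc i = k")
    case True
    then show ?thesis using assms by (auto simp: E_def)
  next
    case False
    then show ?thesis using assms by (auto simp: E_def)
  qed
  have fin: "finite E" by (rule finite_subset[OF sub]) simp
  show ?thesis
    unfolding G
  proof unfold_locales
    show "symmetric (with_proj \<lparr>pverts = {..<n}, parcs = E \<union> E\<inverse>\<rparr>)"
      by (simp add: symmetric_def sym_Un_converse)
  qed (use sub irr fin in \<open>auto simp: split_beta\<close>)
qed

definition X_graph :: "nat \<Rightarrow> nat pair_pre_digraph" where
  "X_graph n = cycle_pendants 3 n"

definition X_tilde_graph :: "nat \<Rightarrow> nat pair_pre_digraph" where
  "X_tilde_graph n = cycle_pendants 4 n"

end

theory Submission
  imports Defs "Jordan_Normal_Form.Schur_Decomposition"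
begin

text \<open>
  Expanding \<open>1 / (n - t)\<close> in powers of \<open>t / n\<close>, the resolvent energy is a weighted sum of the
  spectral moments, that is, of the numbers of closed walks of given length. Every unicyclic graph
  arises from a cycle by successively attaching leaves, and attaching a leaf to \<open>u\<close> changes the
  moments in a simple way: the third one stays, the fourth grows by \<open>4 d(u) + 2\<close> and the fifth by
  five times the number of closed 3-walks at \<open>u\<close>. By induction, the fourth moment of a graph that
  contains a triangle, but no vertex adjacent to all others (as in \<open>X\<^sub>n\<close>), lies below that of
  \<open>X\<^sub>n\<close> by at least \<open>4 n - 16\<close>; a triangle-free graph loses \<open>6\<close> in the third moment; and a
  triangle-free graph without a vertex of degree \<open>n - 2\<close> (as in the graph built from the 4-cycle)
  loses at least \<open>4 n - 20\<close> in the fourth. These gaps exceed the contribution of all higher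
  moments, which is controlled by a bound on the spectral radius, itself deduced from the fourth
  moment. The energies of the two extremal graphs are computed exactly from polynomials of degree 5
  that annihilate their spectra.
\<close>

section \<open>Closed walks in unicyclic graphs\<close>

text \<open>The obstacle is that the competing effects all have the same size. Beyond
  \<open>1 + 2 / n ^ 2 + 2 / n ^ 3\<close> the comparison is decided at order
  \<open>1 / n ^ 4\<close>: there a gap of about \<open>4 n\<close> in the fourth moment counts 4, a
  missing triangle counts 6, and the sixth moment of an extremal graph, about
  \<open>2 n ^ 3\<close>, counts 2. The tail of the competitor's series, once charged to its fourth
  moment with a factor \<open>K\<close> from a spectral bound
  \<open>t\<^sup>2 \<le> K * (n - t)\<close>, costs \<open>2 K\<close>, as that moment is at most
  about \<open>2 n ^ 2\<close>. Hence \<open>K\<close> must stay below 3 for graphs with a triangle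
  and below 6 for triangle-free ones compared with the triangle graph. From below, the fourth moment
  yields only \<open>t\<^sup>2\<close> up to about \<open>sqrt 2 * n\<close>, so \<open>K\<close>
  cannot be less than \<open>sqrt 2\<close>. The constants \<open>9 / 4\<close> and
  \<open>7 / 2\<close> lie in these windows and already work at the smallest orders. In the
  bipartite case the same count applies with \<open>K = c / n\<close> and a bound by
  \<open>K * (n\<^sup>2 - t\<^sup>2)\<close>; the choice there is \<open>c = 3 / 2\<close>.\<close>

lemma sum_sum_delta:
  fixes c :: "'b :: comm_monoid_add"
  assumes "finite V" "u \<in> V"
  shows "(\<Sum>x\<in>V. \<Sum>y\<in>V. if x = u then if y = u then c else 0 else 0) = c"
proof -
  have "(\<Sum>y\<in>V. if x = u then if y = u then c else 0 else 0) = (if x = u then c else 0)" for x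
    using assms by simp
  then show ?thesis using assms by simp
qed

locale simple_adjacency =
  fixes E :: "'a \<Rightarrow> 'a \<Rightarrow> bool"
  assumes adj_sym: "E x y \<Longrightarrow> E y x" and adj_irrefl: "\<not> E x x"
begin

definition adj :: "'a \<Rightarrow> 'a \<Rightarrow> real" where
  "adj x y = of_bool (E x y)"

definition deg :: "'a set \<Rightarrow> 'a \<Rightarrow> nat" where
  "deg V x = card {y \<in> V. E x y}"

definition walk2 :: "'a set \<Rightarrow> 'a \<Rightarrow> 'a \<Rightarrow> real" where
  "walk2 V x y = (\<Sum>z\<in>V. adj x z * adj z y)"

definition walk3 :: "'a set \<Rightarrow> 'a \<Rightarrow> 'a \<Rightarrow> real" where
  "walk3 V x y = (\<Sum>z\<in>V. adj x z * walk2 V z y)"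

text \<open>
  \<open>mom3\<close>, \<open>mom4\<close> and \<open>mom5\<close> are the traces of the third, fourth and fifth power of the adjacency
  matrix of the subgraph induced on \<open>V\<close>. The relation itself is not restricted to \<open>V\<close>, so that
  removing a leaf only changes \<open>V\<close>.
\<close>

definition mom3 :: "'a set \<Rightarrow> real" where
  "mom3 V = (\<Sum>x\<in>V. walk3 V x x)"

definition mom4 :: "'a set \<Rightarrow> real" where
  "mom4 V = (\<Sum>x\<in>V. \<Sum>y\<in>V. (walk2 V x y)\<^sup>2)"

definition mom5 :: "'a set \<Rightarrow> real" where
  "mom5 V = (\<Sum>x\<in>V. \<Sum>y\<in>V. walk2 V x y * walk3 V x y)"

text \<open>Connectedness is expressed by the absence of proper nonempty subsets closed under adjacency.\<close>

definition unicyclic_on :: "'a set \<Rightarrow> bool" where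
  "unicyclic_on V \<longleftrightarrow> finite V \<and> V \<noteq> {} \<and> (\<Sum>x\<in>V. deg V x) = 2 * card V \<and>
     (\<forall>S\<subseteq>V. S \<noteq> {} \<longrightarrow> (\<forall>x\<in>S. \<forall>y\<in>V. E x y \<longrightarrow> y \<in> S) \<longrightarrow> S = V)"

lemma adj_commute: "adj x y = adj y x"
  by (auto simp: adj_def dest: adj_sym)

lemma adj_self [simp]: "adj x x = 0"
  by (simp add: adj_def adj_irrefl)

lemma adj_nonneg [simp]: "0 \<le> adj x y"
  by (simp add: adj_def)

lemma adj_square [simp]: "adj x y * adj x y = adj x y"
  by (simp add: adj_def)

lemma walk2_commute: "walk2 V x y = walk2 V y x"
  unfolding walk2_def by (simp add: adj_commute[of x] adj_commute[of y] mult.commute)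

lemma walk2_nonneg [simp]: "0 \<le> walk2 V x y"
  by (simp add: walk2_def sum_nonneg)

lemma walk3_alt: "walk3 V x y = (\<Sum>z\<in>V. walk2 V x z * adj z y)"
proof -
  have "walk3 V x y = (\<Sum>z\<in>V. \<Sum>w\<in>V. adj x z * adj z w * adj w y)"
    by (simp add: walk3_def walk2_def sum_distrib_left mult.assoc)
  also have "\<dots> = (\<Sum>w\<in>V. \<Sum>z\<in>V. adj x z * adj z w * adj w y)"
    by (rule sum.swap)
  also have "\<dots> = (\<Sum>z\<in>V. walk2 V x z * adj z y)"
    by (simp add: walk2_def sum_distrib_right)
  finally show ?thesis .
qed

lemma walk3_commute: "walk3 V x y = walk3 V y x"
proof -
  have "walk3 V x y = (\<Sum>z\<in>V. walk2 V x z * adj z y)" by (rule walk3_alt)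
  also have "\<dots> = (\<Sum>z\<in>V. adj y z * walk2 V z x)"
    by (simp add: walk2_commute[of V x] adj_commute[of y] mult.commute)
  finally show ?thesis by (simp add: walk3_def)
qed

lemma walk3_nonneg [simp]: "0 \<le> walk3 V x y"
  by (simp add: walk3_def sum_nonneg)

lemma deg_eq_sum_adj:
  assumes "finite V"
  shows "real (deg V x) = (\<Sum>y\<in>V. adj x y)"
  using assms by (simp add: deg_def adj_def Int_def flip: sum.inter_filter)

lemma walk2_self:
  assumes "finite V"
  shows "walk2 V x x = deg V x"
  by (simp add: walk2_def adj_commute[of _ x] deg_eq_sum_adj assms)

lemma walk2_le_deg:
  assumes "finite V"
  shows "walk2 V x y \<le> deg V x"
  unfolding walk2_def deg_eq_sum_adj[OF assms]
  by (intro sum_mono) (simp add: adj_def)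

lemma unicyclic_on_finite: "unicyclic_on V \<Longrightarrow> finite V"
  by (simp add: unicyclic_on_def)

lemma unicyclic_on_closed:
  assumes "unicyclic_on V" "S \<subseteq> V" "S \<noteq> {}" "\<And>x y. x \<in> S \<Longrightarrow> y \<in> V \<Longrightarrow> E x y \<Longrightarrow> y \<in> S"
  shows "S = V"
  using assms unfolding unicyclic_on_def by blast

lemma sum_deg: "unicyclic_on V \<Longrightarrow> (\<Sum>x\<in>V. deg V x) = 2 * card V"
  by (simp add: unicyclic_on_def)

lemma deg_plus_one_le_card:
  assumes "finite V" "x \<in> V"
  shows "deg V x + 1 \<le> card V"
proof -
  have "deg V x \<le> card (V - {x})"
    unfolding deg_def using assms by (intro card_mono) (auto simp: adj_irrefl)
  moreover have "card V > 0" using assms by (auto simp: card_gt_0_iff)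
  ultimately show ?thesis using assms by simp
qed

text \<open>The degree sum \<open>2 n\<close> cannot exceed \<open>n * (n - 1)\<close>.\<close>

lemma card_ge_3:
  assumes "unicyclic_on V"
  shows "3 \<le> card V"
proof -
  have fin: "finite V" and ne: "V \<noteq> {}" using assms by (auto simp: unicyclic_on_def)
  have "2 * card V = (\<Sum>x\<in>V. deg V x)" by (simp add: sum_deg assms)
  also have "\<dots> \<le> (\<Sum>x\<in>V. card V - 1)"
    using deg_plus_one_le_card[OF fin] by (intro sum_mono) fastforce
  finally have "2 * card V \<le> card V * (card V - 1)" by simp
  moreover have "card V > 0" using fin ne by (simp add: card_gt_0_iff)
  ultimately show ?thesis by simp
qed

lemma deg_pos:
  assumes "unicyclic_on V" "x \<in> V"
  shows "0 < deg V x"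
proof (rule ccontr)
  assume "\<not> 0 < deg V x"
  then have "{y \<in> V. E x y} = {}"
    using unicyclic_on_finite[OF assms(1)] by (simp add: deg_def)
  then have "{x} = V" using assms by (intro unicyclic_on_closed) auto
  then show False using card_ge_3[OF assms(1)] by auto
qed

section \<open>Attaching a leaf \<open>l\<close> at the vertex \<open>u\<close>\<close>

context
  fixes V :: "'a set" and u l :: 'a
  assumes fin: "finite V" and u: "u \<in> V" and l: "l \<notin> V" and leaf: "\<forall>y\<in>V. E l y \<longleftrightarrow> y = u"
begin

lemma adj_leaf: "y \<in> V \<Longrightarrow> adj l y = of_bool (y = u)" "y \<in> V \<Longrightarrow> adj y l = of_bool (y = u)"
  using leaf by (auto simp: adj_def dest: adj_sym)

lemma deg_insert_leaf:
  "deg (insert l V) l = 1"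
  "x \<in> V \<Longrightarrow> deg (insert l V) x = deg V x + of_bool (x = u)"
proof -
  have "{y \<in> insert l V. E l y} = {u}" using leaf u adj_irrefl by auto
  then show "deg (insert l V) l = 1" by (simp add: deg_def)
next
  assume x: "x \<in> V"
  have "E x l \<longleftrightarrow> x = u" using leaf x by (auto dest: adj_sym)
  then have "{y \<in> insert l V. E x y} = {y \<in> V. E x y} \<union> (if x = u then {l} else {})"
    by auto
  then show "deg (insert l V) x = deg V x + of_bool (x = u)"
    using fin l by (simp add: deg_def card_insert_if)
qed

text \<open>A walk enters and leaves \<open>l\<close> only via \<open>u\<close>, so the one new
  2-walk between old vertices is \<open>u, l, u\<close>.\<close>

lemma walk2_insert_leaf:
  "x \<in> V \<Longrightarrow> y \<in> V \<Longrightarrow> walk2 (insert l V) x y = walk2 V x y + of_bool (x = u \<and> y = u)"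
  "y \<in> V \<Longrightarrow> walk2 (insert l V) l y = adj u y"
  "y \<in> V \<Longrightarrow> walk2 (insert l V) y l = adj y u"
  "walk2 (insert l V) l l = 1"
  using fin l u by (auto simp: walk2_def adj_leaf)

text \<open>A new 3-walk between old vertices is the detour \<open>u, l, u\<close> preceded or
  followed by an edge at \<open>u\<close>. A 3-walk from \<open>l\<close> continues with a 2-walk
  from \<open>u\<close>, and \<open>of_bool (y = u)\<close> accounts for the one that returns
  through \<open>l\<close>.\<close>

lemma walk3_insert_leaf:
  "x \<in> V \<Longrightarrow> y \<in> V \<Longrightarrow> walk3 (insert l V) x y =
     walk3 V x y + adj x u * of_bool (y = u) + of_bool (x = u) * adj u y"
  "y \<in> V \<Longrightarrow> walk3 (insert l V) l y = walk2 V u y + of_bool (y = u)"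
  "y \<in> V \<Longrightarrow> walk3 (insert l V) y l = walk2 V y u + of_bool (y = u)"
  "walk3 (insert l V) l l = 0"
proof -
  assume xy: "x \<in> V" "y \<in> V"
  have "(\<Sum>z\<in>V. adj x z * (of_bool (z = u \<and> y = u))) = adj x u * of_bool (y = u)"
    using fin u by (cases "y = u") (auto simp: if_distrib cong: if_cong)
  then show "walk3 (insert l V) x y =
     walk3 V x y + adj x u * of_bool (y = u) + of_bool (x = u) * adj u y"
    using fin l xy
    by (simp add: walk3_def walk2_insert_leaf adj_leaf distrib_left sum.distrib)
next
  assume y: "y \<in> V"
  show *: "walk3 (insert l V) l y = walk2 V u y + of_bool (y = u)" 
    using fin l u y by (simp add: walk3_def walk2_insert_leaf adj_leaf)
  then show "walk3 (insert l V) y l = walk2 V y u + of_bool (y = u)"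
    by (simp add: walk3_commute[of _ _ l] walk2_commute[of _ y])
next
  show "walk3 (insert l V) l l = 0"
    using fin l u by (simp add: walk3_def walk2_insert_leaf adj_leaf)
qed

lemma mom3_insert_leaf: "mom3 (insert l V) = mom3 V"
  using fin l by (auto simp: mom3_def walk3_insert_leaf intro!: sum.cong)

text \<open>With \<open>d\<close> the old degree of \<open>u\<close>, the entry of the squared
  matrix at \<open>(u, u)\<close> grows from \<open>d\<close> to \<open>d + 1\<close>, which adds
  \<open>2 d + 1\<close> to the sum of squares; the new row and column add \<open>d\<close> each,
  the new diagonal entry adds 1.\<close>

lemma mom4_insert_leaf: "mom4 (insert l V) = mom4 V + 4 * deg V u + 2"
proof -
  have "(\<Sum>x\<in>V. \<Sum>y\<in>V. (walk2 (insert l V) x y)\<^sup>2) =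
     (\<Sum>x\<in>V. \<Sum>y\<in>V. (walk2 V x y)\<^sup>2 + (if x = u then if y = u then 2 * walk2 V u u + 1 else 0 else 0))"
    by (intro sum.cong refl) (auto simp: walk2_insert_leaf power2_eq_square algebra_simps)
  also have "\<dots> = mom4 V + 2 * deg V u + 1"
    using fin u by (simp add: mom4_def sum.distrib walk2_self sum_sum_delta)
  finally have *: "(\<Sum>x\<in>V. \<Sum>y\<in>V. (walk2 (insert l V) x y)\<^sup>2) = mom4 V + 2 * deg V u + 1" .
  have "(\<Sum>y\<in>V. (walk2 (insert l V) l y)\<^sup>2) = deg V u"
    by (simp add: walk2_insert_leaf power2_eq_square deg_eq_sum_adj fin)
  moreover have "(\<Sum>y\<in>V. (walk2 (insert l V) y l)\<^sup>2) = deg V u"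
    by (simp add: walk2_insert_leaf power2_eq_square deg_eq_sum_adj fin adj_commute[of _ u])
  ultimately show ?thesis
    using fin l * by (simp add: mom4_def walk2_insert_leaf sum.distrib)
qed

text \<open>A closed 5-walk through \<open>l\<close> meets it only once, since two visits would
  leave a closed 1-walk. Cutting out the detour \<open>u, l, u\<close> gives a closed 3-walk at
  \<open>u\<close>, and the factor 5 counts the starting points.\<close>

lemma mom5_insert_leaf: "mom5 (insert l V) = mom5 V + 5 * walk3 V u u"
proof -
  let ?f = "\<lambda>x y. walk2 V x y * (adj x u * of_bool (y = u))"
  let ?g = "\<lambda>x y. walk2 V x y * (of_bool (x = u) * adj u y)"
  have "(\<Sum>x\<in>V. \<Sum>y\<in>V. walk2 (insert l V) x y * walk3 (insert l V) x y) =
     (\<Sum>x\<in>V. \<Sum>y\<in>V. walk2 V x y * walk3 V x y + ?f x y + ?g x y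
        + (if x = u then if y = u then walk3 V u u else 0 else 0))"
    by (intro sum.cong refl) (auto simp: walk2_insert_leaf walk3_insert_leaf algebra_simps)
  also have "\<dots> = mom5 V + (\<Sum>x\<in>V. \<Sum>y\<in>V. ?f x y) + (\<Sum>x\<in>V. \<Sum>y\<in>V. ?g x y) + walk3 V u u"
    using fin u by (simp add: mom5_def sum.distrib sum_sum_delta)
  also have "(\<Sum>x\<in>V. \<Sum>y\<in>V. ?f x y) = walk3 V u u"
  proof -
    have "(\<Sum>y\<in>V. ?f x y) = (\<Sum>y\<in>V. if y = u then walk2 V x u * adj x u else 0)" for x
      by (intro sum.cong) auto
    then have "(\<Sum>y\<in>V. ?f x y) = walk2 V u x * adj x u" for x
      using fin u walk2_commute[of V x u] by simp
    then show ?thesis by (simp add: walk3_alt)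
  qed
  also have "(\<Sum>x\<in>V. \<Sum>y\<in>V. ?g x y) = (\<Sum>x\<in>V. of_bool (x = u) * (\<Sum>y\<in>V. walk2 V u y * adj u y))"
    by (intro sum.cong refl) (auto simp: sum_distrib_left)
  also have "\<dots> = walk3 V u u"
    using fin u by (simp add: walk3_alt adj_commute[of u])
  finally have *: "(\<Sum>x\<in>V. \<Sum>y\<in>V. walk2 (insert l V) x y * walk3 (insert l V) x y) =
     mom5 V + 3 * walk3 V u u" by simp
  have "(\<Sum>y\<in>V. adj u y * (walk2 V u y + of_bool (y = u))) = walk3 V u u"
    using fin u by (simp add: distrib_left sum.distrib walk3_def walk2_commute[of V u])
  moreover have "(\<Sum>y\<in>V. adj y u * (walk2 V y u + of_bool (y = u))) = walk3 V u u"
    using fin u by (simp add: distrib_left sum.distrib walk3_def adj_commute[of u])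
  ultimately show ?thesis
    using fin l * by (simp add: mom5_def walk2_insert_leaf walk3_insert_leaf sum.distrib)
qed

end

text \<open>A closed subset \<open>S\<close> of \<open>V\<close> yields one of the larger graph:
  \<open>insert l S\<close> if \<open>u\<close> is in \<open>S\<close>, and \<open>S\<close> itself
  otherwise. The degree sum drops by 2, in step with the one vertex removed.\<close>

lemma unicyclic_on_remove_leaf:
  assumes uni: "unicyclic_on (insert l V)" and l: "l \<notin> V" and u: "u \<in> V"
    and leaf: "\<forall>y\<in>V. E l y \<longleftrightarrow> y = u"
  shows "unicyclic_on V"
  unfolding unicyclic_on_def
proof (intro conjI allI impI)
  show fin: "finite V" using uni by (simp add: unicyclic_on_def)
  show "V \<noteq> {}" using u by auto
  have "2 * card (insert l V) = (\<Sum>x\<in>insert l V. deg (insert l V) x)"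
    by (simp only: sum_deg[OF uni])
  also have "\<dots> = 1 + (\<Sum>x\<in>V. deg V x + of_bool (x = u))"
    using fin l by (simp add: deg_insert_leaf[OF fin u l leaf])
  also have "\<dots> = 2 + (\<Sum>x\<in>V. deg V x)"
    using fin u by (simp add: sum.distrib)
  finally show "(\<Sum>x\<in>V. deg V x) = 2 * card V" using fin l by simp
next
  fix S assume S: "S \<subseteq> V" "S \<noteq> {}" "\<forall>x\<in>S. \<forall>y\<in>V. E x y \<longrightarrow> y \<in> S"
  show "S = V"
  proof (cases "u \<in> S")
    case True
    have "insert l S = insert l V"
      using S True leaf by (intro unicyclic_on_closed[OF uni]) (auto simp: adj_irrefl)
    then show ?thesis using S l by auto
  next
    case False
    have "S = insert l V"
    proof (rule unicyclic_on_closed[OF uni])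
      fix x y assume "x \<in> S" "y \<in> insert l V" "E x y"
      then show "y \<in> S" using S False leaf adj_sym by (metis insertE subsetD)
    qed (use S in auto)
    then show ?thesis using S l by auto
  qed
qed

text \<open>Without a leaf all degrees are at least 2, and as they sum to \<open>2 n\<close> they
  all equal 2. The base case records only this regularity, which together with connectedness
  describes a cycle.\<close>

lemma unicyclic_on_induct [consumes 1, case_names cycle leaf]:
  assumes "unicyclic_on V"
    and cycle: "\<And>V. unicyclic_on V \<Longrightarrow> (\<And>x. x \<in> V \<Longrightarrow> deg V x = 2) \<Longrightarrow> P V"
    and leaf: "\<And>V u l. unicyclic_on V \<Longrightarrow> P V \<Longrightarrow> unicyclic_on (insert l V) \<Longrightarrow> u \<in> V \<Longrightarrow> l \<notin> V \<Longrightarrow>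
      \<forall>y\<in>V. E l y \<longleftrightarrow> y = u \<Longrightarrow> P (insert l V)"
  shows "P V"
  using assms(1)
proof (induction "card V" arbitrary: V)
  case 0
  then show ?case using card_ge_3 by fastforce
next
  case (Suc n)
  note uni = Suc.prems
  have fin: "finite V" using uni by (rule unicyclic_on_finite)
  show ?case
  proof (cases "\<exists>l\<in>V. deg V l = 1")
    case True
    then obtain l where l: "l \<in> V" "deg V l = 1" by blast
    then obtain u where u: "{y \<in> V. E l y} = {u}" by (auto simp: deg_def card_1_singleton_iff)
    define W where "W = V - {l}"
    have V: "V = insert l W" using l by (auto simp: W_def)
    have W: "l \<notin> W" "u \<in> W" "\<forall>y\<in>W. E l y \<longleftrightarrow> y = u"
      using u adj_irrefl by (auto simp: W_def)
    have uW: "unicyclic_on W" using unicyclic_on_remove_leaf[OF uni[unfolded V]] W by blast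
    have "n = card W" using Suc.hyps(2) l fin by (simp add: W_def)
    then have "P W" using uW Suc.hyps(1) by blast
    then show ?thesis unfolding V using leaf uW W uni[unfolded V] by blast
  next
    case False
    have ge: "2 \<le> deg V x" if "x \<in> V" for x
      using deg_pos[OF uni that] False that by (metis One_nat_def less_2_cases_iff not_le not_gr_zero)
    have "(\<Sum>x\<in>V. deg V x - 2) = 0"
      using sum_subtractf_nat[of V "\<lambda>_. 2" "deg V"] ge sum_deg[OF uni] by simp
    then have "deg V x = 2" if "x \<in> V" for x
      using ge[OF that] that fin by fastforce
    then show ?thesis using cycle uni by blast
  qed
qed

definition triangle_free :: "'a set \<Rightarrow> bool" where
  "triangle_free V \<longleftrightarrow> \<not> (\<exists>x\<in>V. \<exists>y\<in>V. \<exists>z\<in>V. E x y \<and> E y z \<and> E z x)"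

lemma triangle_free_walk3:
  assumes "triangle_free V" "x \<in> V"
  shows "walk3 V x x = 0"
proof -
  have "adj x z * (adj z w * adj w x) = 0" if "z \<in> V" "w \<in> V" for z w
  proof -
    have "\<not> (E x z \<and> E z w \<and> E w x)" using that assms unfolding triangle_free_def by blast
    then show ?thesis by (auto simp: adj_def)
  qed
  then show ?thesis unfolding walk3_def walk2_def sum_distrib_left by (intro sum.neutral ballI)
qed

lemma triangle_free_mom3: "triangle_free V \<Longrightarrow> mom3 V = 0"
  by (simp add: mom3_def triangle_free_walk3)

lemma mom3_eq_0_triangle_free:
  assumes fin: "finite V" and "mom3 V = 0"
  shows "triangle_free V"
  unfolding triangle_free_def
proof
  assume "\<exists>x\<in>V. \<exists>y\<in>V. \<exists>z\<in>V. E x y \<and> E y z \<and> E z x"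
  then obtain x y z where V: "x \<in> V" "y \<in> V" "z \<in> V" and E: "E x y" "E y z" "E z x" by blast
  have "walk3 V x x = 0"
    using assms V by (simp add: mom3_def sum_nonneg_eq_0_iff)
  then have "adj x y * walk2 V y x = 0"
    using fin V unfolding walk3_def by (subst (asm) sum_nonneg_eq_0_iff) auto
  then have "walk2 V y x = 0" using E by (simp add: adj_def)
  then have "adj y z * adj z x = 0"
    using fin V unfolding walk2_def by (subst (asm) sum_nonneg_eq_0_iff) auto
  then show False using E by (simp add: adj_def)
qed

text \<open>Both neighbours of a triangle vertex already lie in the triangle, so the triangle is
  closed under adjacency and exhausts the connected graph.\<close>

lemma two_regular_triangle:
  assumes uni: "unicyclic_on V" and reg: "\<And>x. x \<in> V \<Longrightarrow> deg V x = 2"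
    and V: "x \<in> V" "y \<in> V" "z \<in> V" and E: "E x y" "E y z" "E z x"
  shows "V = {x, y, z}"
proof -
  have fin: "finite V" using uni by (rule unicyclic_on_finite)
  have nb: "{w \<in> V. E p w} = {q, r}"
    if "p \<in> V" "q \<in> V" "r \<in> V" "E p q" "E q r" "E r p" for p q r
  proof -
    have "{q, r} \<subseteq> {w \<in> V. E p w}" using that by (auto intro: adj_sym)
    moreover have "card {q, r} = 2" using that adj_irrefl by (auto simp: card_insert_if)
    moreover have "card {w \<in> V. E p w} = 2" using reg that by (simp add: deg_def)
    ultimately show ?thesis using fin by (intro card_subset_eq[symmetric]) auto
  qed
  have "{x, y, z} = V"
    using V nb[OF V E] nb[OF V(2,3,1) E(2,3,1)] nb[OF V(3,1,2) E(3,1,2)]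
    by (intro unicyclic_on_closed[OF uni]) auto
  then show ?thesis by simp
qed

lemma triangle_moments:
  assumes V: "V = {x, y, z}" and E: "E x y" "E y z" "E z x"
  shows "card V = 3" "mom3 V = 6" "mom4 V = 18" "mom5 V = 30" "w \<in> V \<Longrightarrow> walk3 V w w = 2"
proof -
  have neq: "x \<noteq> y" "y \<noteq> z" "z \<noteq> x" "y \<noteq> x" "z \<noteq> y" "x \<noteq> z" using E adj_irrefl by auto
  have adj: "adj x y = 1" "adj y x = 1" "adj y z = 1" "adj z y = 1" "adj z x = 1" "adj x z = 1"
    using E by (auto simp: adj_def intro: adj_sym)
  note simps = V neq adj walk2_def walk3_def
  show "card V = 3" by (simp add: simps)
  show "mom3 V = 6" by (simp add: mom3_def simps)
  show "mom4 V = 18" by (simp add: mom4_def simps)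
  show "mom5 V = 30" by (simp add: mom5_def simps)
  show "w \<in> V \<Longrightarrow> walk3 V w w = 2" by (auto simp: simps)
qed

section \<open>Moments of cycles, and bounds on the third and fifth moment\<close>

lemma sum_walk2:
  assumes "finite V"
  shows "(\<Sum>y\<in>V. walk2 V x y) = (\<Sum>z\<in>V. adj x z * deg V z)"
  unfolding walk2_def deg_eq_sum_adj[OF assms] sum_distrib_left by (rule sum.swap)

text \<open>Each row of the squared matrix has entries at most 2 and sum 4, so its squares sum to at
  most 8. The 4-cycle attains this.\<close>

lemma two_regular_mom4:
  assumes fin: "finite V" and reg: "\<And>x. x \<in> V \<Longrightarrow> deg V x = 2"
  shows "mom4 V \<le> 8 * card V"
proof -
  have "(\<Sum>y\<in>V. (walk2 V x y)\<^sup>2) \<le> 8" if x: "x \<in> V" for x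
  proof -
    have "(\<Sum>y\<in>V. (walk2 V x y)\<^sup>2) \<le> (\<Sum>y\<in>V. walk2 V x y * 2)"
      using walk2_le_deg[OF fin, of x] reg[OF x]
      by (intro sum_mono) (auto simp: power2_eq_square intro!: mult_left_mono)
    also have "\<dots> = 2 * (\<Sum>z\<in>V. adj x z * 2)"
      using sum_walk2[OF fin, of x] reg by (simp flip: sum_distrib_right)
    also have "\<dots> = 8"
      using reg[OF x] deg_eq_sum_adj[OF fin, of x] by (simp flip: sum_distrib_right)
    finally show ?thesis .
  qed
  then have "mom4 V \<le> (\<Sum>x\<in>V. 8)" unfolding mom4_def by (intro sum_mono)
  then show ?thesis by (simp add: mult.commute)
qed

text \<open>Triangle-freeness kills the diagonal of \<open>walk3\<close>. Off the diagonal a row of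
  \<open>walk2\<close> sums to 2, while the entries of \<open>walk3\<close> are at most 4.\<close>

lemma two_regular_mom5:
  assumes fin: "finite V" and reg: "\<And>x. x \<in> V \<Longrightarrow> deg V x = 2" and tf: "triangle_free V"
  shows "mom5 V \<le> 8 * card V"
proof -
  have row: "(\<Sum>y\<in>V. walk2 V x y * walk3 V x y) \<le> 8" if x: "x \<in> V" for x
  proof -
    have adj2: "(\<Sum>z\<in>V. adj x z * 2) = 4"
      using reg[OF x] deg_eq_sum_adj[OF fin, of x] by (simp flip: sum_distrib_right)
    have w3: "walk3 V x y \<le> 4" for y
    proof -
      have "walk3 V x y \<le> (\<Sum>z\<in>V. adj x z * 2)"
        unfolding walk3_def
        using walk2_le_deg[OF fin] reg by (intro sum_mono mult_left_mono) (auto, metis of_nat_numeral)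
      then show ?thesis using adj2 by simp
    qed
    have "(\<Sum>y\<in>V. walk2 V x y) = 4"
      using sum_walk2[OF fin, of x] reg adj2 by simp
    then have off: "(\<Sum>y\<in>V - {x}. walk2 V x y) = 2"
      using fin x reg by (simp add: sum_diff1 walk2_self)
    have "(\<Sum>y\<in>V. walk2 V x y * walk3 V x y) = (\<Sum>y\<in>V - {x}. walk2 V x y * walk3 V x y)"
      using fin x tf by (simp add: sum_diff1 triangle_free_walk3)
    also have "\<dots> \<le> (\<Sum>y\<in>V - {x}. walk2 V x y * 4)"
      using w3 by (intro sum_mono mult_left_mono) auto
    also have "\<dots> = 8" using off by (simp flip: sum_distrib_right)
    finally show ?thesis .
  qed
  have "mom5 V \<le> (\<Sum>x\<in>V. 8)" unfolding mom5_def using row by (intro sum_mono)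
  then show ?thesis by (simp add: mult.commute)
qed

lemma two_regular_cases [consumes 2]:
  assumes "unicyclic_on V" "\<forall>x\<in>V. deg V x = 2"
  obtains "triangle_free V" | x y z where "V = {x, y, z}" "E x y" "E y z" "E z x"
  using two_regular_triangle[OF assms(1) bspec[OF assms(2)]]
  unfolding triangle_free_def by blast

text \<open>\<open>mom3\<close> counts each triangle six times and \<open>walk3 V x x\<close> counts
  each triangle through \<open>x\<close> twice. The initial cycle contributes at most one triangle,
  and a leaf lies in none.\<close>

lemma unicyclic_mom3_walk3:
  assumes "unicyclic_on V"
  shows "(mom3 V = 0 \<or> mom3 V = 6) \<and> (\<forall>x\<in>V. walk3 V x x \<le> 2)"
  using assms
proof (induction rule: unicyclic_on_induct)
  case (cycle V)
  have "\<forall>x\<in>V. deg V x = 2" using cycle by blast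
  with cycle(1) show ?case
  proof (cases rule: two_regular_cases)
    case 1
    then show ?thesis by (simp add: triangle_free_mom3 triangle_free_walk3)
  next
    case (2 x y z)
    then show ?thesis using triangle_moments(2,5)[of V x y z] by auto
  qed
next
  case (leaf V u l)
  note l = unicyclic_on_finite[OF leaf.hyps(1)] leaf.hyps(3,4,5)
  show ?case
    using leaf.IH mom3_insert_leaf[OF l] walk3_insert_leaf[OF l] by auto
qed

text \<open>The value 10 per vertex is forced by the triangle, where \<open>mom5\<close> is 30. Each
  leaf keeps it, adding at most \<open>5 * 2\<close>; triangle-free cycles stay below it with
  8.\<close>

lemma unicyclic_mom5:
  assumes "unicyclic_on V"
  shows "mom5 V \<le> 10 * card V"
  using assms
proof (induction rule: unicyclic_on_induct)
  case (cycle V)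
  have "\<forall>x\<in>V. deg V x = 2" using cycle by blast
  with cycle(1) show ?case
  proof (cases rule: two_regular_cases)
    case 1
    then show ?thesis
      using two_regular_mom5[of V] unicyclic_on_finite[OF cycle(1)] cycle(2) by fastforce
  next
    case (2 x y z)
    then show ?thesis using triangle_moments[of V x y z] by auto
  qed
next
  case (leaf V u l)
  note l = unicyclic_on_finite[OF leaf.hyps(1)] leaf.hyps(3,4,5)
  have "walk3 V u u \<le> 2" using unicyclic_mom3_walk3[OF leaf.hyps(1)] leaf by blast
  then show ?case
    using leaf l by (simp add: mom5_insert_leaf[OF l])
qed

section \<open>Vertices adjacent to all, or to all but one, of the other vertices\<close>

lemma dominating_vertex_structure:
  assumes uni: "unicyclic_on V" and c: "c \<in> V" and dc: "deg V c + 1 = card V"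
  obtains v w where "v \<in> V - {c}" "w \<in> V - {c}" "v \<noteq> w" "\<forall>y\<in>V - {c}. E c y"
    "\<forall>x\<in>V - {c}. \<forall>y\<in>V - {c}. E x y \<longleftrightarrow> x = v \<and> y = w \<or> x = w \<and> y = v"
proof -
  have fin: "finite V" using uni by (rule unicyclic_on_finite)
  have "{y \<in> V. E c y} = V - {c}"
    using fin c dc by (intro card_subset_eq) (auto simp: adj_irrefl deg_def)
  then have Ec: "E c y" if "y \<in> V - {c}" for y using that by blast
  define R where "R = (SIGMA x:V - {c}. {y \<in> V - {c}. E x y})"
  have d: "deg V x = Suc (card {y \<in> V - {c}. E x y})" if "x \<in> V - {c}" for x
  proof -
    have "{y \<in> V. E x y} = insert c {y \<in> V - {c}. E x y}"
      using Ec[OF that] c by (auto intro: adj_sym)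
    then show ?thesis using fin by (simp add: deg_def)
  qed
  \<comment> \<open>The edges at \<open>c\<close> use \<open>2 (n - 1)\<close> of the degree sum
    \<open>2 n\<close>. This leaves a single edge among the other vertices, which appears in
    \<open>R\<close> as two ordered pairs.\<close>
  have "2 * card V = deg V c + (\<Sum>x\<in>V - {c}. deg V x)"
    using sum_deg[OF uni] fin c by (simp add: sum.remove)
  also have "(\<Sum>x\<in>V - {c}. deg V x) = (\<Sum>x\<in>V - {c}. Suc (card {y \<in> V - {c}. E x y}))"
    using d by (intro sum.cong) auto
  also have "\<dots> = card R + card (V - {c})"
    using fin by (simp add: R_def sum_Suc)
  finally have "card R = 2" using dc fin c by simp
  then obtain p q where R: "R = {p, q}" "p \<noteq> q" by (auto simp: card_2_iff)
  obtain v w where p: "p = (v, w)" by (cases p)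
  have vw: "v \<in> V - {c}" "w \<in> V - {c}" "E v w" using R p by (auto simp: R_def)
  then have "(w, v) \<in> R" by (auto simp: R_def intro: adj_sym)
  moreover have "v \<noteq> w" using vw adj_irrefl by auto
  ultimately have R': "R = {(v, w), (w, v)}" using R p by auto
  have "E x y \<longleftrightarrow> x = v \<and> y = w \<or> x = w \<and> y = v" if "x \<in> V - {c}" "y \<in> V - {c}" for x y
  proof -
    have "E x y \<longleftrightarrow> (x, y) \<in> R" using that by (auto simp: R_def)
    then show ?thesis by (auto simp: R')
  qed
  then show ?thesis using that vw \<open>v \<noteq> w\<close> Ec by blast
qed

text \<open>Serves the moment where a leaf attached away from \<open>c\<close> destroys domination:
  the fourth moment then grows by at most \<open>4 * 2 + 2\<close>.\<close>

lemma dominating_vertex_deg: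
  assumes "unicyclic_on V" "c \<in> V" "deg V c + 1 = card V" "u \<in> V - {c}"
  shows "deg V u \<le> 2"
proof -
  obtain v w where *: "v \<in> V - {c}" "w \<in> V - {c}" "v \<noteq> w" "\<forall>y\<in>V - {c}. E c y"
    "\<forall>x\<in>V - {c}. \<forall>y\<in>V - {c}. E x y \<longleftrightarrow> x = v \<and> y = w \<or> x = w \<and> y = v"
    using dominating_vertex_structure[OF assms(1-3)] .
  then have "{y \<in> V. E u y} \<subseteq> {c, if u = v then w else v}"
    using assms(4) by auto
  then have "deg V u \<le> card {c, if u = v then w else v}"
    unfolding deg_def by (intro card_mono) auto
  also have "\<dots> \<le> 2" by (simp add: card_insert_if)
  finally show ?thesis .
qed

text \<open>A dominating vertex would form a triangle with the one edge that avoids it.\<close>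

lemma triangle_free_deg:
  assumes "unicyclic_on V" "triangle_free V" "c \<in> V"
  shows "deg V c + 2 \<le> card V"
proof (rule ccontr)
  assume "\<not> deg V c + 2 \<le> card V"
  moreover have "deg V c + 1 \<le> card V"
    using deg_plus_one_le_card assms unicyclic_on_finite by blast
  ultimately have "deg V c + 1 = card V" by simp
  from dominating_vertex_structure[OF assms(1,3) this]
  obtain v w where *: "v \<in> V - {c}" "w \<in> V - {c}" "v \<noteq> w" "\<forall>y\<in>V - {c}. E c y"
    "\<forall>x\<in>V - {c}. \<forall>y\<in>V - {c}. E x y \<longleftrightarrow> x = v \<and> y = w \<or> x = w \<and> y = v"
    .
  then have "E c v" "E v w" "E w c" by (auto intro: adj_sym)
  then show False using assms * unfolding triangle_free_def by blast
qed

text \<open>The neighbours of \<open>c\<close> are independent for want of triangles, so every edge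
  avoiding \<open>c\<close> joins its only non-neighbour \<open>w\<close> to the set
  \<open>P\<close> of neighbours of \<open>w\<close>. The degree sum
  \<open>2 n = 2 (n - 2) + 2 * card P\<close> gives \<open>card P = 2\<close>: a 4-cycle
  \<open>c, p, w, q\<close> with leaves at \<open>c\<close>.\<close>

lemma almost_dominating_vertex_structure:
  assumes uni: "unicyclic_on V" and tf: "triangle_free V" and c: "c \<in> V"
    and dc: "deg V c + 2 = card V"
  obtains w p q where "w \<in> V - {c}" "\<not> E c w" "p \<in> V - {c, w}" "q \<in> V - {c, w}" "p \<noteq> q"
    "\<forall>y\<in>V - {c, w}. E c y"
    "\<forall>x\<in>V - {c}. \<forall>y\<in>V - {c}.
       E x y \<longleftrightarrow> x = w \<and> (y = p \<or> y = q) \<or> y = w \<and> (x = p \<or> x = q)"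
proof -
  have fin: "finite V" using uni by (rule unicyclic_on_finite)
  define N where "N = {y \<in> V. E c y}"
  have cN: "card N + 2 = card V" using dc by (simp add: N_def deg_def)
  have NV: "N \<subseteq> V - {c}" by (auto simp: N_def adj_irrefl)
  have finN: "finite N" using NV fin by (auto intro: finite_subset)
  have "card (V - {c} - N) = 1"
    using NV finN fin c cN by (simp add: card_Diff_subset)
  then obtain w where w: "V - {c} - N = {w}" by (auto simp: card_1_singleton_iff)
  have wV: "w \<in> V - {c}" "w \<notin> N" using w by auto
  have Veq: "V - {c, w} = N" using w NV by auto
  have Ecw: "\<not> E c w" using wV by (auto simp: N_def)
  have noN: "\<not> E x y" if "x \<in> N" "y \<in> N" for x y
    using that c tf unfolding N_def triangle_free_def by (blast intro: adj_sym)
  define P where "P = {y \<in> V. E w y}"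
  have PN: "P \<subseteq> N" using Veq Ecw adj_irrefl by (auto simp: P_def dest: adj_sym)
  have dN: "deg V x = 1 + of_bool (x \<in> P)" if x: "x \<in> N" for x
  proof -
    have "{y \<in> V. E x y} = insert c (if x \<in> P then {w} else {})"
      using x c wV Veq noN[OF x] unfolding N_def P_def by (auto dest: adj_sym)
    then show ?thesis using wV by (auto simp: deg_def)
  qed
  have V: "V = insert c (insert w N)" using Veq c wV by auto
  have "2 * card V = deg V c + (deg V w + (\<Sum>x\<in>N. deg V x))"
  proof -
    have "c \<notin> insert w N" using wV NV by auto
    then have "sum (deg V) (insert c (insert w N)) = deg V c + (deg V w + (\<Sum>x\<in>N. deg V x))"
      using finN wV by simp
    then show ?thesis using sum_deg[OF uni] V by simp
  qed
  also have "(\<Sum>x\<in>N. deg V x) = card N + card P"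
  proof -
    have "(\<Sum>x\<in>N. deg V x) = (\<Sum>x\<in>N. 1) + (\<Sum>x\<in>N. of_bool (x \<in> P))"
      using dN by (simp only: sum.distrib[symmetric] cong: sum.cong)
    also have "(\<Sum>x\<in>N. of_bool (x \<in> P)) = card P"
      using finN PN by (simp add: Int_absorb1)
    finally show ?thesis by simp
  qed
  finally have "card P = 2" using cN dc by (simp add: deg_def P_def)
  then obtain p q where P: "P = {p, q}" "p \<noteq> q" by (auto simp: card_2_iff)
  have pq: "p \<in> V - {c, w}" "q \<in> V - {c, w}" using P PN Veq by auto
  have "E x y \<longleftrightarrow> x = w \<and> (y = p \<or> y = q) \<or> y = w \<and> (x = p \<or> x = q)"
    if xy: "x \<in> V - {c}" "y \<in> V - {c}" for x y
  proof -
    have Ew: "E w z \<longleftrightarrow> z = p \<or> z = q" if "z \<in> V" for z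
      using that P unfolding P_def by blast
    consider "x = w" | "y = w" | "x \<in> N" "y \<in> N" using xy Veq by blast
    then show ?thesis
    proof cases
      case 1
      then show ?thesis using Ew xy pq by auto
    next
      case 2
      then show ?thesis using Ew xy pq by (auto dest: adj_sym)
    next
      case 3
      then show ?thesis using noN wV by blast
    qed
  qed
  moreover have "E c y" if "y \<in> V - {c, w}" for y using that Veq by (auto simp: N_def)
  ultimately show ?thesis using that wV Ecw pq P(2) by blast
qed

lemma almost_dominating_vertex_deg:
  assumes "unicyclic_on V" "triangle_free V" "c \<in> V" "deg V c + 2 = card V" "u \<in> V - {c}"
  shows "deg V u \<le> 2"
proof -
  obtain w p q where *: "w \<in> V - {c}" "\<not> E c w" "p \<in> V - {c, w}" "q \<in> V - {c, w}" "p \<noteq> q"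
    "\<forall>y\<in>V - {c, w}. E c y"
    "\<forall>x\<in>V - {c}. \<forall>y\<in>V - {c}.
       E x y \<longleftrightarrow> x = w \<and> (y = p \<or> y = q) \<or> y = w \<and> (x = p \<or> x = q)"
    using almost_dominating_vertex_structure[OF assms(1-4)] .
  have "y \<in> (if u = w then {p, q} else {c, w})" if "y \<in> V" "E u y" for y
  proof (cases "y = c")
    case True
    then show ?thesis using *(2) adj_sym[of w c] that by auto
  next
    case False
    then have "u = w \<and> (y = p \<or> y = q) \<or> y = w \<and> (u = p \<or> u = q)"
      using *(7) that assms(5) by blast
    then show ?thesis using *(3,4) by auto
  qed
  then have "{y \<in> V. E u y} \<subseteq> (if u = w then {p, q} else {c, w})"
    by blast
  then have "deg V u \<le> card (if u = w then {p, q} else {c, w})"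
    unfolding deg_def by (intro card_mono) auto
  also have "\<dots> \<le> 2" by (simp add: card_insert_if)
  finally show ?thesis .
qed

text \<open>The average degree is 2.\<close>

lemma deg_eq_2_of_le_2:
  assumes uni: "unicyclic_on V" and le: "\<And>x. x \<in> V \<Longrightarrow> deg V x \<le> 2" and x: "x \<in> V"
  shows "deg V x = 2"
proof -
  have fin: "finite V" using uni by (rule unicyclic_on_finite)
  have "(\<Sum>x\<in>V. 2 - deg V x) = 0"
    using sum_subtractf_nat[of V "deg V" "\<lambda>_. 2"] le sum_deg[OF uni] by simp
  then show ?thesis using le[OF x] x fin by fastforce
qed

lemma triangle_free_card:
  assumes uni: "unicyclic_on V" and tf: "triangle_free V"
  shows "4 \<le> card V"
proof (rule ccontr)
  assume "\<not> 4 \<le> card V"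
  then have le: "deg V x \<le> 1" if "x \<in> V" for x
    using triangle_free_deg[OF uni tf that] by simp
  obtain x where "x \<in> V" using uni by (auto simp: unicyclic_on_def)
  moreover have "deg V y \<le> 2" if "y \<in> V" for y using le[OF that] by simp
  ultimately have "deg V x = 2" by (rule deg_eq_2_of_le_2[OF uni, rotated])
  then show False using le[OF \<open>x \<in> V\<close>] by simp
qed

text \<open>At order at most 4 the degrees are at most \<open>card V - 2 \<le> 2\<close>, so the
  graph is 2-regular. Containing a triangle, it is a triangle, and there every vertex
  dominates.\<close>

lemma not_dominated_card:
  assumes uni: "unicyclic_on V" and ntf: "\<not> triangle_free V"
    and nd: "\<And>c. c \<in> V \<Longrightarrow> deg V c + 1 \<noteq> card V"
  shows "5 \<le> card V"
proof (rule ccontr)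
  assume "\<not> 5 \<le> card V"
  then have le: "deg V x \<le> 2" if "x \<in> V" for x
    using deg_plus_one_le_card[OF unicyclic_on_finite[OF uni] that] nd[OF that] by simp
  have reg: "deg V x = 2" if "x \<in> V" for x
    by (rule deg_eq_2_of_le_2[OF uni _ that]) (rule le)
  then have "\<forall>x\<in>V. deg V x = 2" by blast
  with uni show False
  proof (cases rule: two_regular_cases)
    case 1
    then show ?thesis using ntf by simp
  next
    case (2 x y z)
    then have "card V = 3" "x \<in> V" using triangle_moments(1)[of V x y z] by auto
    then show ?thesis using nd[of x] reg[of x] by simp
  qed
qed

section \<open>Upper bounds for the fourth moment\<close>

lemma unicyclic_mom4_le:
  assumes "unicyclic_on V"
  shows "mom4 V \<le> 2 * (real (card V))\<^sup>2 - 4 * card V + 12 \<or> triangle_free V"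
  using assms
proof (induction rule: unicyclic_on_induct)
  case (cycle V)
  have "\<forall>x\<in>V. deg V x = 2" using cycle by blast
  with cycle(1) show ?case
  proof (cases rule: two_regular_cases)
    case (2 x y z)
    then show ?thesis using triangle_moments[of V x y z] by auto
  qed auto
next
  case (leaf V u l)
  note l = unicyclic_on_finite[OF leaf.hyps(1)] leaf.hyps(3,4,5)
  have "triangle_free (insert l V)" if "triangle_free V"
    using triangle_free_mom3[OF that] mom3_insert_leaf[OF l] l(1)
    by (intro mom3_eq_0_triangle_free) auto
  \<comment> \<open>From \<open>n\<close> to \<open>n + 1\<close> the bound grows by
    \<open>4 (n - 1) + 2\<close>, exactly what a leaf at a vertex of degree \<open>n - 1\<close>
    adds. The constant 12 is set by the triangle, whose fourth moment is 18.\<close>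
  moreover have "real (deg V u) + 1 \<le> real (card V)"
    using deg_plus_one_le_card[of V u] l by (metis of_nat_1 of_nat_add of_nat_le_iff)
  ultimately show ?case
    using leaf.IH l by (auto simp: mom4_insert_leaf[OF l] power2_eq_square algebra_simps)
qed

lemma triangle_free_insert_leaf:
  assumes "finite V" "u \<in> V" "l \<notin> V" "\<forall>y\<in>V. E l y \<longleftrightarrow> y = u"
  shows "triangle_free (insert l V) \<longleftrightarrow> triangle_free V"
proof -
  have "triangle_free W \<longleftrightarrow> mom3 W = 0" if "finite W" for W
    using triangle_free_mom3 mom3_eq_0_triangle_free[OF that] by blast
  then show ?thesis using mom3_insert_leaf[OF assms] assms(1) by simp
qed

text \<open>The bound grows by \<open>4 (n - 2) + 2\<close>, the cost of a leaf at degree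
  \<open>n - 2\<close>. The constant 28 comes from the step out of the dominated case: a leaf at
  degree 2 adds 10 to \<open>2 n\<^sup>2 - 4 n + 12\<close>, which is exactly this bound at
  \<open>n + 1\<close>.\<close>

lemma not_dominated_mom4:
  assumes "unicyclic_on V" "\<not> triangle_free V" "\<And>c. c \<in> V \<Longrightarrow> deg V c + 1 \<noteq> card V"
  shows "mom4 V \<le> 2 * (real (card V))\<^sup>2 - 8 * card V + 28"
  using assms
proof (induction rule: unicyclic_on_induct)
  case (cycle V)
  have "\<forall>x\<in>V. deg V x = 2" using cycle by blast
  with cycle(1) show ?case
  proof (cases rule: two_regular_cases)
    case (2 x y z)
    then have "card V = 3" "x \<in> V" using triangle_moments(1)[of V x y z] by auto
    then show ?thesis using cycle(2)[of x] cycle(4)[of x] by simp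
  qed (use cycle in auto)
next
  case (leaf V u l)
  note l = unicyclic_on_finite[OF leaf.hyps(1)] leaf.hyps(3,4,5)
  have ntf: "\<not> triangle_free V" using leaf.prems(1) triangle_free_insert_leaf[OF l] by simp
  have "deg V u + 1 \<noteq> card V"
    using leaf.prems(2)[of u] l by (auto simp: deg_insert_leaf[OF l])
  then have du: "deg V u + 2 \<le> card V" using deg_plus_one_le_card[OF l(1,2)] by simp
  show ?case
  proof (cases "\<exists>c\<in>V. deg V c + 1 = card V")
    case True
    then obtain c where c: "c \<in> V" "deg V c + 1 = card V" by blast
    then have "u \<in> V - {c}" using du l by auto
    then have "real (deg V u) \<le> 2" using dominating_vertex_deg[OF leaf.hyps(1) c] by fastforce
    then show ?thesis
      using unicyclic_mom4_le[OF leaf.hyps(1)] ntf l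
      by (auto simp: mom4_insert_leaf[OF l] power2_eq_square algebra_simps)
  next
    case False
    then have "mom4 V \<le> 2 * (real (card V))\<^sup>2 - 8 * card V + 28" using leaf.IH ntf by blast
    moreover have "real (deg V u) + 2 \<le> real (card V)" using du by linarith
    ultimately show ?thesis
      using l by (auto simp: mom4_insert_leaf[OF l] power2_eq_square algebra_simps)
  qed
qed

text \<open>Degrees are at most \<open>n - 2\<close>, and a leaf at such a vertex adds just the
  growth of the bound. The 4-cycle, with fourth moment 32, sets the constant; for an arbitrary cycle
  the slack over \<open>8 n\<close> is \<open>2 (n - 4)\<^sup>2\<close>.\<close>

lemma triangle_free_mom4:
  assumes "unicyclic_on V" "triangle_free V"
  shows "mom4 V \<le> 2 * (real (card V))\<^sup>2 - 8 * card V + 32"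
  using assms
proof (induction rule: unicyclic_on_induct)
  case (cycle V)
  have "mom4 V \<le> 8 * card V"
    using two_regular_mom4[of V] cycle unicyclic_on_finite by blast
  moreover have "0 \<le> 2 * (real (card V) - 4)\<^sup>2" by simp
  ultimately show ?case by (simp add: power2_eq_square algebra_simps)
next
  case (leaf V u l)
  note l = unicyclic_on_finite[OF leaf.hyps(1)] leaf.hyps(3,4,5)
  have tf: "triangle_free V" using leaf.prems(1) triangle_free_insert_leaf[OF l] by simp
  have "real (deg V u) + 2 \<le> real (card V)"
    using triangle_free_deg[OF leaf.hyps(1) tf l(2)] by linarith
  then show ?case
    using leaf.IH[OF tf] l by (auto simp: mom4_insert_leaf[OF l] power2_eq_square algebra_simps)
qed

text \<open>Same scheme as \<open>not_dominated_mom4\<close>, with growth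
  \<open>4 (n - 3) + 2\<close>. The constant 52 makes the bound at \<open>n + 1\<close> equal to
  \<open>2 n\<^sup>2 - 8 n + 32\<close> plus the 10 of a leaf at degree 2.\<close>

lemma not_almost_dominated_mom4:
  assumes "unicyclic_on V" "triangle_free V" "\<And>c. c \<in> V \<Longrightarrow> deg V c + 2 \<noteq> card V"
  shows "mom4 V \<le> 2 * (real (card V))\<^sup>2 - 12 * card V + 52"
  using assms
proof (induction rule: unicyclic_on_induct)
  case (cycle V)
  have "mom4 V \<le> 8 * card V"
    using two_regular_mom4[of V] cycle unicyclic_on_finite by blast
  moreover have "0 \<le> 2 * (real (card V) - 5)\<^sup>2" by simp
  ultimately show ?case by (simp add: power2_eq_square algebra_simps)
next
  case (leaf V u l)
  note l = unicyclic_on_finite[OF leaf.hyps(1)] leaf.hyps(3,4,5)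
  have tf: "triangle_free V" using leaf.prems(1) triangle_free_insert_leaf[OF l] by simp
  have "deg V u + 2 \<noteq> card V"
    using leaf.prems(2)[of u] l by (auto simp: deg_insert_leaf[OF l])
  then have du: "deg V u + 3 \<le> card V" using triangle_free_deg[OF leaf.hyps(1) tf l(2)] by simp
  show ?case
  proof (cases "\<exists>c\<in>V. deg V c + 2 = card V")
    case True
    then obtain c where c: "c \<in> V" "deg V c + 2 = card V" by blast
    then have "u \<in> V - {c}" using du l by auto
    then have "real (deg V u) \<le> 2" using almost_dominating_vertex_deg[OF leaf.hyps(1) tf c] by fastforce
    then show ?thesis
      using triangle_free_mom4[OF leaf.hyps(1) tf] l
      by (auto simp: mom4_insert_leaf[OF l] power2_eq_square algebra_simps)
  next
    case False
    then have "mom4 V \<le> 2 * (real (card V))\<^sup>2 - 12 * card V + 52" using leaf.IH tf by blast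
    moreover have "real (deg V u) + 3 \<le> real (card V)" using du by linarith
    ultimately show ?thesis
      using l by (auto simp: mom4_insert_leaf[OF l] power2_eq_square algebra_simps)
  qed
qed

text \<open>Below order 6 all degrees are at most 2, hence equal to 2. At order 4 that is the
  excluded degree \<open>n - 2\<close>; at order 5, counting edges from both sides gives
  \<open>card A = card B\<close>, against parity. This discards the 5-cycle, at whose order the
  fourth-moment gap \<open>4 n - 20\<close> is zero.\<close>

lemma bipartite_not_almost_dominated_card:
  assumes uni: "unicyclic_on V" and tf: "triangle_free V"
    and nd: "\<And>c. c \<in> V \<Longrightarrow> deg V c + 2 \<noteq> card V"
    and AB: "V = A \<union> B" "A \<inter> B = {}"
      "\<And>x y. x \<in> V \<Longrightarrow> y \<in> V \<Longrightarrow> E x y \<Longrightarrow> x \<in> A \<and> y \<in> B \<or> x \<in> B \<and> y \<in> A"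
  shows "6 \<le> card V"
proof (rule ccontr)
  assume less: "\<not> 6 \<le> card V"
  then have le: "deg V x \<le> 2" if "x \<in> V" for x
    using triangle_free_deg[OF uni tf that] nd[OF that] by simp
  have reg: "deg V x = 2" if "x \<in> V" for x
    by (rule deg_eq_2_of_le_2[OF uni _ that]) (rule le)
  have fin: "finite V" "finite A" "finite B" using uni AB(1) by (auto dest: unicyclic_on_finite)
  have "card V \<noteq> 4" using nd reg uni by (auto simp: unicyclic_on_def)
  then have "card V = 5" using less triangle_free_card[OF uni tf] by simp
  then have five: "card A + card B = 5" using AB fin by (simp add: card_Un_disjoint)
  have rowA: "(\<Sum>y\<in>B. adj x y) = 2" if "x \<in> A" for x
  proof -
    have "2 = (\<Sum>y\<in>V. adj x y)" using reg[of x] that AB(1) deg_eq_sum_adj[OF fin(1), of x] by simp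
    also have "\<dots> = (\<Sum>y\<in>B. adj x y)"
      using fin AB that by (intro sum.mono_neutral_right) (auto simp: adj_def)
    finally show ?thesis by simp
  qed
  have rowB: "(\<Sum>x\<in>A. adj x y) = 2" if "y \<in> B" for y
  proof -
    have "2 = (\<Sum>x\<in>V. adj x y)"
      using reg[of y] that AB(1) deg_eq_sum_adj[OF fin(1), of y] by (simp add: adj_commute[of _ y])
    also have "\<dots> = (\<Sum>x\<in>A. adj x y)"
      using fin AB that by (intro sum.mono_neutral_right) (auto simp: adj_def)
    finally show ?thesis by simp
  qed
  have "(\<Sum>x\<in>A. \<Sum>y\<in>B. adj x y) = (\<Sum>y\<in>B. \<Sum>x\<in>A. adj x y)" by (rule sum.swap)
  then have "2 * card A = 2 * card B" using rowA rowB by simp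
  then show False using five by presburger
qed

end

section \<open>Power sums of eigenvalues\<close>

lemma monic_eq_prod_proots:
  fixes p :: "'a :: field poly"
  assumes "monic p" "size (proots p) = degree p"
  shows "p = (\<Prod>x\<in>#proots p. [:- x, 1:])"
  using assms
proof (induction "degree p" arbitrary: p)
  case 0
  then have "p = 1" using monic_degree_0 by metis
  then show ?case by simp
next
  case (Suc d)
  then obtain x where "x \<in># proots p" by (metis Zero_not_Suc multiset_nonemptyE size_empty)
  moreover have p0: "p \<noteq> 0" using Suc by auto
  ultimately have "poly p x = 0" by simp
  then obtain q where q: "p = [:- x, 1:] * q" by (auto simp: poly_eq_0_iff_dvd)
  have q0: "q \<noteq> 0" using p0 q by auto
  have "degree p = Suc (degree q)" unfolding q using q0 by (subst degree_mult_eq) auto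
  moreover have "proots p = add_mset x (proots q)"
    unfolding q using q0 by (subst proots_mult) auto
  moreover have "monic q"
    using Suc.prems(1) lead_coeff_mult[of "[:- x, 1:]" q] unfolding q by simp
  ultimately show ?case using Suc.hyps(1)[of q] Suc.hyps(2) Suc.prems(2) q by simp
qed

definition trace_mat :: "'a :: comm_monoid_add mat \<Rightarrow> 'a" where
  "trace_mat A = (\<Sum>i<dim_row A. A $$ (i, i))"

lemma trace_mat_mult_commute:
  fixes A B :: "'a :: comm_semiring_0 mat"
  assumes "A \<in> carrier_mat n m" "B \<in> carrier_mat m n"
  shows "trace_mat (A * B) = trace_mat (B * A)"
proof -
  have "trace_mat (A * B) = (\<Sum>i<n. \<Sum>j<m. A $$ (i, j) * B $$ (j, i))"
    using assms by (simp add: trace_mat_def scalar_prod_def atLeast0LessThan)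
  also have "\<dots> = (\<Sum>j<m. \<Sum>i<n. A $$ (i, j) * B $$ (j, i))" by (rule sum.swap)
  also have "\<dots> = trace_mat (B * A)"
    using assms by (simp add: trace_mat_def scalar_prod_def atLeast0LessThan mult.commute)
  finally show ?thesis .
qed

lemma trace_mat_similar:
  fixes A B :: "'a :: comm_ring_1 mat"
  assumes "similar_mat_wit A B P Q"
  shows "trace_mat A = trace_mat B"
proof -
  define n where "n = dim_row A"
  note w = similar_mat_witD[OF n_def assms]
  have "trace_mat A = trace_mat (P * (B * Q))" using w by simp
  also have "\<dots> = trace_mat (B * Q * P)" using w by (intro trace_mat_mult_commute) auto
  also have "B * Q * P = B" using w by simp
  finally show ?thesis .
qed

lemma upper_triangular_pow:
  fixes B :: "'a :: comm_ring_1 mat"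
  assumes B: "B \<in> carrier_mat n n" and ut: "upper_triangular B"
  shows "upper_triangular (B ^\<^sub>m k) \<and> (\<forall>i<n. (B ^\<^sub>m k) $$ (i, i) = (B $$ (i, i)) ^ k)"
proof (induction k)
  case 0
  then show ?case using B by simp
next
  case (Suc k)
  let ?C = "B ^\<^sub>m k"
  have C: "?C \<in> carrier_mat n n" using B by simp
  have z: "?C $$ (i, l) * B $$ (l, j) = 0" if "i < n" "l < n" "j < i \<or> j = i \<and> l \<noteq> i" for i j l
  proof (cases "l < i")
    case True
    then show ?thesis using Suc that C by (auto dest: upper_triangularD)
  next
    case False
    then have "j < l" using that by auto
    then show ?thesis using ut that B by (auto dest: upper_triangularD)
  qed
  have entry: "(?C * B) $$ (i, j) = (\<Sum>l<n. ?C $$ (i, l) * B $$ (l, j))" if "i < n" "j < n" for i j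
    using that B C by (simp add: scalar_prod_def atLeast0LessThan)
  have "upper_triangular (?C * B)"
    using B C entry z by (intro upper_triangularI) auto
  moreover have "(?C * B) $$ (i, i) = (B $$ (i, i)) ^ Suc k" if i: "i < n" for i
  proof -
    have "(?C * B) $$ (i, i) = (\<Sum>l<n. if l = i then ?C $$ (i, i) * B $$ (i, i) else 0)"
      unfolding entry[OF i i] using z[OF i] by (intro sum.cong) auto
    also have "\<dots> = (B $$ (i, i)) ^ Suc k" using Suc i by (simp add: mult.commute)
    finally show ?thesis .
  qed
  ultimately show ?case by simp
qed

text \<open>The size hypothesis says that the characteristic polynomial splits over the reals, so
  the triangularization stays real.\<close>

lemma real_schur:
  fixes A :: "real mat"
  assumes A: "A \<in> carrier_mat n n" and sz: "size (proots (char_poly A)) = n"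
  obtains B P Q where "B \<in> carrier_mat n n" "similar_mat_wit A B P Q" "upper_triangular B"
    "mset (diag_mat B) = proots (char_poly A)"
proof -
  obtain es where es: "mset es = proots (char_poly A)" using ex_mset by blast
  have "char_poly A = (\<Prod>x\<in>#proots (char_poly A). [:- x, 1:])"
    using degree_monic_char_poly[OF A] sz by (intro monic_eq_prod_proots) auto
  then have c: "char_poly A = (\<Prod>e\<leftarrow>es. [:- e, 1:])"
    by (metis es mset_map prod_mset_prod_list)
  obtain B P Q where s: "schur_decomposition A es = (B, P, Q)" by (cases "schur_decomposition A es")
  have "similar_mat_wit A B P Q" "upper_triangular B" "diag_mat B = es"
    using schur_decomposition[OF A c s] by auto
  moreover from this have "B \<in> carrier_mat n n" using similar_mat_witD2[OF A] by blast
  ultimately show ?thesis using that es by blast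
qed

lemma sum_mset_diag_mat:
  "(\<Sum>x\<in>#mset (diag_mat B). g x) = (\<Sum>i<dim_row B. g (B $$ (i, i)))"
  by (simp add: diag_mat_def sum_mset_sum_list o_def interv_sum_list_conv_sum_set_nat atLeast0LessThan
      flip: mset_map)

text \<open>The trace is invariant under similarity, and the powers of a triangular form carry the
  powers of the eigenvalues on the diagonal.\<close>

lemma sum_proots_power:
  fixes A :: "real mat"
  assumes A: "A \<in> carrier_mat n n" and sz: "size (proots (char_poly A)) = n"
  shows "(\<Sum>x\<in>#proots (char_poly A). x ^ k) = trace_mat (A ^\<^sub>m k)"
proof -
  obtain B P Q where B: "B \<in> carrier_mat n n" and sim: "similar_mat_wit A B P Q"
    and ut: "upper_triangular B" and es: "mset (diag_mat B) = proots (char_poly A)"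
    using real_schur[OF assms] .
  have "trace_mat (A ^\<^sub>m k) = trace_mat (B ^\<^sub>m k)"
    by (rule trace_mat_similar[OF similar_mat_wit_pow[OF sim]])
  also have "\<dots> = (\<Sum>i<n. (B $$ (i, i)) ^ k)"
    using upper_triangular_pow[OF B ut] B by (simp add: trace_mat_def)
  also have "\<dots> = (\<Sum>x\<in>#proots (char_poly A). x ^ k)"
    using B by (simp flip: es add: sum_mset_diag_mat)
  finally show ?thesis by simp
qed

text \<open>Negating a triangular form of \<open>A\<close> gives one of the negated matrix. By
  similarity it is also one of \<open>A\<close>, so both diagonals list the same roots.\<close>

lemma proots_symmetric:
  fixes A :: "real mat"
  assumes A: "A \<in> carrier_mat n n" and sz: "size (proots (char_poly A)) = n"
    and sim: "similar_mat A ((- 1) \<cdot>\<^sub>m A)"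
  shows "image_mset uminus (proots (char_poly A)) = proots (char_poly A)"
proof -
  obtain B P Q where B: "B \<in> carrier_mat n n" and AB: "similar_mat_wit A B P Q"
    and ut: "upper_triangular B" and es: "mset (diag_mat B) = proots (char_poly A)"
    using real_schur[OF A sz] .
  let ?C = "(- 1) \<cdot>\<^sub>m B"
  have C: "?C \<in> carrier_mat n n" "upper_triangular ?C"
    using B ut by (auto intro!: upper_triangularI dest: upper_triangularD)
  have "similar_mat A B" using AB by (auto simp: similar_mat_def)
  then have "similar_mat A ?C" using sim similar_mat_smult similar_mat_trans by blast
  then have "char_poly A = (\<Prod>a\<leftarrow>diag_mat ?C. [:- a, 1:])"
    using char_poly_similar char_poly_upper_triangular[OF C] by metis
  moreover have "0 \<notin> set (map (\<lambda>a. [:- a, 1:]) (diag_mat ?C))" by auto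
  ultimately have "proots (char_poly A) = mset (diag_mat ?C)"
    using proots_prod_list[of "map (\<lambda>a. [:- a, 1:]) (diag_mat ?C)"] by (simp add: o_def)
  also have "diag_mat ?C = map uminus (diag_mat B)" using B by (simp add: diag_mat_def)
  finally show ?thesis by (simp add: es)
qed

definition power_sum :: "real multiset \<Rightarrow> nat \<Rightarrow> real" where
  "power_sum S k = (\<Sum>x\<in>#S. x ^ k)"

text \<open>A common normal form for all polynomial sums over spectra; this explains the explicit
  zero coefficients in later summands.\<close>

lemma sum_mset_quintic:
  fixes S :: "real multiset"
  shows "(\<Sum>x\<in>#S. a0 + a1 * x + a2 * x ^ 2 + a3 * x ^ 3 + a4 * x ^ 4 + a5 * x ^ 5) =
    a0 * size S + a1 * power_sum S 1 + a2 * power_sum S 2 + a3 * power_sum S 3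
      + a4 * power_sum S 4 + a5 * power_sum S 5"
  by (induction S) (auto simp: power_sum_def algebra_simps)

text \<open>A single square is at most the sum of all of them. For a unicyclic graph the second
  power sum is \<open>2 n\<close>, so the shift by 1 lowers the right-hand side by
  \<open>3 n\<close>.\<close>

lemma shifted_square_le_power_sums:
  assumes "t \<in># S"
  shows "(t\<^sup>2 - 1)\<^sup>2 \<le> power_sum S 4 - 2 * power_sum S 2 + size S"
proof -
  obtain T where S: "S = add_mset t T" using assms by (metis multi_member_split)
  have "0 \<le> (\<Sum>x\<in>#T. (x\<^sup>2 - 1)\<^sup>2)" by (induction T) auto
  then have "(t\<^sup>2 - 1)\<^sup>2 \<le> (\<Sum>x\<in>#S. (x\<^sup>2 - 1)\<^sup>2)" by (simp add: S)
  also have "\<dots> = (\<Sum>x\<in>#S. 1 + 0 * x + (- 2) * x ^ 2 + 0 * x ^ 3 + 1 * x ^ 4 + 0 * x ^ 5)"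
    by (intro arg_cong[where f = sum_mset] image_mset_cong)
       (simp add: power2_eq_square power4_eq_xxxx algebra_simps)
  also have "\<dots> = power_sum S 4 - 2 * power_sum S 2 + size S"
    unfolding sum_mset_quintic by simp
  finally show ?thesis .
qed

text \<open>The terms \<open>t ^ k / n ^ (k + 1)\<close> with \<open>k \<le> 5\<close> miss
  \<open>1 / (n - t)\<close> by exactly \<open>t ^ 6 / (n ^ 6 * (n - t))\<close>, and the hypothesis
  bounds this by \<open>K * t ^ 4 / n ^ 6\<close>.\<close>

lemma resolvent_sum_le:
  fixes n K :: real
  assumes n: "0 < n" and K: "\<And>t. t \<in># S \<Longrightarrow> t < n \<and> t\<^sup>2 \<le> K * (n - t)"
  shows "(\<Sum>t\<in>#S. 1 / (n - t)) \<le>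
    size S / n + power_sum S 1 / n ^ 2 + power_sum S 2 / n ^ 3 + power_sum S 3 / n ^ 4
      + (1 / n ^ 5 + K / n ^ 6) * power_sum S 4 + power_sum S 5 / n ^ 6"
proof -
  have "1 / (n - t) \<le> 1 / n + (1 / n ^ 2) * t + (1 / n ^ 3) * t ^ 2 + (1 / n ^ 4) * t ^ 3
      + (1 / n ^ 5 + K / n ^ 6) * t ^ 4 + (1 / n ^ 6) * t ^ 5" (is "_ \<le> ?r")
    if "t \<in># S" for t
  proof -
    have t: "0 < n - t" "t\<^sup>2 \<le> K * (n - t)" using K[OF that] by auto
    have "n ^ 6 * ?r * (n - t) = (n ^ 5 + n ^ 4 * t + n ^ 3 * t ^ 2 + n ^ 2 * t ^ 3 + n * t ^ 4
        + t ^ 5) * (n - t) + t ^ 4 * (K * (n - t))"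
      using n by (simp add: field_simps power_numeral_reduce)
    also have "(n ^ 5 + n ^ 4 * t + n ^ 3 * t ^ 2 + n ^ 2 * t ^ 3 + n * t ^ 4 + t ^ 5) * (n - t)
        = n ^ 6 - t ^ 4 * t\<^sup>2"
      by (simp add: algebra_simps power_numeral_reduce)
    also have "n ^ 6 - t ^ 4 * t\<^sup>2 + t ^ 4 * (K * (n - t)) \<ge> n ^ 6"
      using t mult_left_mono[of "t\<^sup>2" "K * (n - t)" "t ^ 4"] by simp
    finally have "n ^ 6 * 1 \<le> n ^ 6 * (?r * (n - t))" by (simp only: mult.assoc mult_1_right)
    then have "1 \<le> ?r * (n - t)" using n by (simp only: mult_le_cancel_left_pos zero_less_power)
    then show ?thesis using t by (simp only: pos_divide_le_eq)
  qed
  then have "(\<Sum>t\<in>#S. 1 / (n - t)) \<le> (\<Sum>t\<in>#S. 1 / n + (1 / n ^ 2) * t + (1 / n ^ 3) * t ^ 2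
      + (1 / n ^ 4) * t ^ 3 + (1 / n ^ 5 + K / n ^ 6) * t ^ 4 + (1 / n ^ 6) * t ^ 5)"
    by (rule sum_mset_mono)
  then show ?thesis unfolding sum_mset_quintic by (simp add: power_numeral_reduce)
qed

text \<open>Averaging over \<open>t\<close> and \<open>- t\<close> replaces
  \<open>1 / (n - t)\<close> by \<open>n / (n\<^sup>2 - t\<^sup>2)\<close>, which expands in even
  powers only. The remainder after \<open>t ^ 4\<close> is
  \<open>t ^ 6 / (n ^ 5 * (n\<^sup>2 - t\<^sup>2))\<close>, at most
  \<open>K * t ^ 4 / n ^ 5\<close>.\<close>

lemma resolvent_sum_symmetric_le:
  fixes n K :: real
  assumes n: "0 < n" and sym: "image_mset uminus S = S"
    and K: "\<And>t. t \<in># S \<Longrightarrow> t\<^sup>2 < n\<^sup>2 \<and> t\<^sup>2 \<le> K * (n\<^sup>2 - t\<^sup>2)"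
  shows "(\<Sum>t\<in>#S. 1 / (n - t)) \<le>
    size S / n + power_sum S 2 / n ^ 3 + (1 + K) / n ^ 5 * power_sum S 4"
proof -
  have "(\<Sum>t\<in>#S. 1 / (n - t)) = (\<Sum>t\<in>#image_mset uminus S. 1 / (n - t))" by (simp add: sym)
  also have "\<dots> = (\<Sum>t\<in>#S. 1 / (n + t))" by (simp add: multiset.map_comp o_def)
  finally have "2 * (\<Sum>t\<in>#S. 1 / (n - t)) = (\<Sum>t\<in>#S. 1 / (n - t) + 1 / (n + t))"
    by (simp add: sum_mset.distrib)
  also have "\<dots> \<le> (\<Sum>t\<in>#S. 2 / n + 0 * t + (2 / n ^ 3) * t ^ 2 + 0 * t ^ 3
      + (2 * (1 + K) / n ^ 5) * t ^ 4 + 0 * t ^ 5)"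
  proof (rule sum_mset_mono)
    fix t assume "t \<in># S"
    then have t: "t\<^sup>2 < n\<^sup>2" "t\<^sup>2 \<le> K * (n\<^sup>2 - t\<^sup>2)" using K by auto
    then have "\<bar>t\<bar> < n" using n abs_square_less_1 power2_less_imp_less[of "\<bar>t\<bar>" n] by simp
    then have nt: "0 < n - t" "0 < n + t" by auto
    then have eq: "1 / (n - t) + 1 / (n + t) = 2 * n / (n\<^sup>2 - t\<^sup>2)"
      by (simp add: field_simps power2_eq_square)
    let ?r = "2 / n + 0 * t + (2 / n ^ 3) * t ^ 2 + 0 * t ^ 3
      + (2 * (1 + K) / n ^ 5) * t ^ 4 + 0 * t ^ 5"
    have "n ^ 5 * ?r * (n\<^sup>2 - t\<^sup>2) = 2 * ((n ^ 4 + n\<^sup>2 * t\<^sup>2 + t ^ 4) * (n\<^sup>2 - t\<^sup>2))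
        + 2 * t ^ 4 * (K * (n\<^sup>2 - t\<^sup>2))"
      using n by (simp add: field_simps power_numeral_reduce)
    also have "(n ^ 4 + n\<^sup>2 * t\<^sup>2 + t ^ 4) * (n\<^sup>2 - t\<^sup>2) = n ^ 6 - t ^ 4 * t\<^sup>2"
      by (simp add: algebra_simps power_numeral_reduce)
    finally have "n ^ 5 * ?r * (n\<^sup>2 - t\<^sup>2) = 2 * (n ^ 6 - t ^ 4 * t\<^sup>2)
        + 2 * t ^ 4 * (K * (n\<^sup>2 - t\<^sup>2))" by (simp only: mult.assoc)
    also have "\<dots> \<ge> 2 * n ^ 6"
      using t mult_left_mono[of "t\<^sup>2" "K * (n\<^sup>2 - t\<^sup>2)" "t ^ 4"] by simp
    finally have "n ^ 5 * (2 * n) \<le> n ^ 5 * (?r * (n\<^sup>2 - t\<^sup>2))"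
      by (simp add: power_numeral_reduce mult.assoc mult.left_commute)
    then have "2 * n \<le> ?r * (n\<^sup>2 - t\<^sup>2)" using n by (simp only: mult_le_cancel_left_pos zero_less_power)
    then show "1 / (n - t) + 1 / (n + t) \<le> ?r" unfolding eq using t by (simp only: pos_divide_le_eq)
  qed
  also have "\<dots> = 2 * (size S / n + power_sum S 2 / n ^ 3 + (1 + K) / n ^ 5 * power_sum S 4)"
    unfolding sum_mset_quintic by (simp add: algebra_simps)
  finally show ?thesis by (simp only: mult_le_cancel_left_pos zero_less_numeral)
qed

text \<open>For the polynomial \<open>p\<close> vanishing on \<open>S\<close>, the value
  \<open>d = p n = p n - p t\<close> is divisible by \<open>n - t\<close>. So
  \<open>1 / (n - t)\<close> is \<open>d\<close>-th part of a quartic in \<open>t\<close>, and its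
  sum needs only the power sums up to 4.\<close>

lemma resolvent_sum_of_roots:
  fixes n :: real
  assumes roots: "\<And>t. t \<in># S \<Longrightarrow> t ^ 5 + a3 * t ^ 3 + a2 * t ^ 2 + a1 * t = 0"
    and d: "d = n ^ 5 + a3 * n ^ 3 + a2 * n ^ 2 + a1 * n" "d \<noteq> 0"
  shows "(\<Sum>t\<in>#S. 1 / (n - t)) = ((n ^ 4 + a3 * n ^ 2 + a2 * n + a1) * size S
    + (n ^ 3 + a3 * n + a2) * power_sum S 1 + (n ^ 2 + a3) * power_sum S 2
    + n * power_sum S 3 + power_sum S 4) / d"
proof -
  let ?r = "\<lambda>t. (n ^ 4 + a3 * n ^ 2 + a2 * n + a1) + (n ^ 3 + a3 * n + a2) * t + (n ^ 2 + a3) * t ^ 2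
    + n * t ^ 3 + 1 * t ^ 4 + 0 * t ^ 5"
  have "1 / (n - t) = ?r t / d" if "t \<in># S" for t
  proof -
    have eq: "?r t * (n - t) = d"
    proof -
      have "?r t * (n - t) = d - (t ^ 5 + a3 * t ^ 3 + a2 * t ^ 2 + a1 * t)"
        unfolding d(1) by (simp add: algebra_simps power_numeral_reduce)
      then show ?thesis using roots[OF that] by simp
    qed
    then have "n - t \<noteq> 0" using d(2) by auto
    then show ?thesis using eq d(2) by (simp add: divide_eq_eq eq_divide_eq mult.commute)
  qed
  then have "(\<Sum>t\<in>#S. 1 / (n - t)) = (\<Sum>t\<in>#S. ?r t / d)"
    by (intro arg_cong[where f = sum_mset] image_mset_cong)
  also have "\<dots> = (\<Sum>t\<in>#S. ?r t) / d"
    by (simp add: divide_inverse sum_mset_distrib_right)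
  finally show ?thesis unfolding sum_mset_quintic by simp
qed

section \<open>Numerical estimates\<close>

text \<open>
  In the next three lemmas the hypothesis is the bound of \<open>shifted_square_le_power_sums\<close>, with the
  extremal value of the fourth moment. The shift by one is needed: for \<open>n = 5\<close> the cruder estimate
  of \<open>t ^ 4\<close> by the fourth moment would not give the constant \<open>9 / 4\<close>.
\<close>

lemma spectral_bound_triangle:
  fixes n t :: real
  assumes n: "5 \<le> n" and t: "(t\<^sup>2 - 1)\<^sup>2 \<le> 2 * n\<^sup>2 - 11 * n + 28"
  shows "t\<^sup>2 \<le> 9 / 4 * (n - t)"
proof (rule ccontr)
  assume neg: "\<not> t\<^sup>2 \<le> 9 / 4 * (n - t)"
  define s where "s = \<bar>t\<bar>"
  \<comment> \<open>The negated claim says \<open>n < 4 / 9 * t\<^sup>2 + t\<close>, hence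
    \<open>n < m\<close>. As \<open>2 * n\<^sup>2 - 11 * n + 28\<close> increases from
    \<open>n = 11 / 4\<close> on, \<open>n\<close> can be replaced by \<open>m\<close>, leaving an
    inequality in \<open>s\<close> alone.\<close>
  define m where "m = 4 / 9 * s\<^sup>2 + s"
  have s: "0 \<le> s" "s\<^sup>2 = t\<^sup>2" by (auto simp: s_def)
  have nm: "n < m" using neg by (auto simp: m_def s_def field_simps)
  \<comment> \<open>At \<open>s = 12 / 5\<close> the value of \<open>m\<close> is 4.96, just under
    5. Expanding around this point gives only positive coefficients.\<close>
  have big: "12 / 5 \<le> s"
  proof (rule ccontr)
    assume "\<not> 12 / 5 \<le> s"
    then have "s < 12 / 5" "s\<^sup>2 \<le> (12 / 5)\<^sup>2" using s(1) by (auto intro!: power_mono)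
    then show False using nm n by (simp add: m_def power2_eq_square)
  qed
  define r where "r = s - 12 / 5"
  have r: "0 \<le> r" "s = r + 12 / 5" using big by (auto simp: r_def)
  have "0 \<le> (m - n) * (2 * (m + n) - 11)" using nm n by (intro mult_nonneg_nonneg) auto
  then have "2 * n\<^sup>2 - 11 * n + 28 \<le> 2 * m\<^sup>2 - 11 * m + 28"
    by (simp add: power2_eq_square algebra_simps)
  then have "(s\<^sup>2 - 1)\<^sup>2 \<le> 2 * m\<^sup>2 - 11 * m + 28" using t s by simp
  then have "49 / 81 * s ^ 4 - 16 / 9 * s ^ 3 + 8 / 9 * s ^ 2 + 11 * s - 27 \<le> 0"
    by (simp add: m_def power_numeral_reduce algebra_simps)
  moreover have "49 / 81 * s ^ 4 - 16 / 9 * s ^ 3 + 8 / 9 * s ^ 2 + 11 * s - 27 > 0"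
  proof -
    have "49 / 81 * s ^ 4 - 16 / 9 * s ^ 3 + 8 / 9 * s ^ 2 + 11 * s - 27 =
        9 / 625 + 6749 / 375 * r + 2024 / 225 * r ^ 2 + 544 / 135 * r ^ 3 + 49 / 81 * r ^ 4"
      unfolding r(2) by (simp add: field_simps power_numeral_reduce)
    also have "\<dots> > 0" using r(1) by (simp add: add_pos_nonneg)
    finally show ?thesis .
  qed
  ultimately show False by simp
qed

lemma spectral_bound_triangle_free:
  fixes n t :: real
  assumes n: "4 \<le> n" and t: "(t\<^sup>2 - 1)\<^sup>2 \<le> 2 * n\<^sup>2 - 11 * n + 32"
  shows "t\<^sup>2 \<le> 7 / 2 * (n - t)"
proof (rule ccontr)
  assume neg: "\<not> t\<^sup>2 \<le> 7 / 2 * (n - t)"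
  define s where "s = \<bar>t\<bar>"
  define m where "m = 2 / 7 * s\<^sup>2 + s"
  have s: "0 \<le> s" "s\<^sup>2 = t\<^sup>2" by (auto simp: s_def)
  have nm: "n < m" using neg by (auto simp: m_def s_def field_simps)
  \<comment> \<open>At \<open>s = 7 / 3\<close> the value of \<open>m\<close> is
    \<open>35 / 9\<close>, just under 4.\<close>
  have big: "7 / 3 \<le> s"
  proof (rule ccontr)
    assume "\<not> 7 / 3 \<le> s"
    then have "s < 7 / 3" "s\<^sup>2 \<le> (7 / 3)\<^sup>2" using s(1) by (auto intro!: power_mono)
    then show False using nm n by (simp add: m_def power2_eq_square)
  qed
  define r where "r = s - 7 / 3"
  have r: "0 \<le> r" "s = r + 7 / 3" using big by (auto simp: r_def)
  have "0 \<le> (m - n) * (2 * (m + n) - 11)" using nm n by (intro mult_nonneg_nonneg) auto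
  then have "2 * n\<^sup>2 - 11 * n + 32 \<le> 2 * m\<^sup>2 - 11 * m + 32"
    by (simp add: power2_eq_square algebra_simps)
  then have "(s\<^sup>2 - 1)\<^sup>2 \<le> 2 * m\<^sup>2 - 11 * m + 32" using t s by simp
  then have "41 / 49 * s ^ 4 - 8 / 7 * s ^ 3 - 6 / 7 * s ^ 2 + 11 * s - 31 \<le> 0"
    by (simp add: m_def power_numeral_reduce algebra_simps)
  moreover have "41 / 49 * s ^ 4 - 8 / 7 * s ^ 3 - 6 / 7 * s ^ 2 + 11 * s - 31 > 0"
  proof -
    have "41 / 49 * s ^ 4 - 8 / 7 * s ^ 3 - 6 / 7 * s ^ 2 + 11 * s - 31 =
        23 / 81 + 833 / 27 * r + 388 / 21 * r ^ 2 + 20 / 3 * r ^ 3 + 41 / 49 * r ^ 4"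
      unfolding r(2) by (simp add: field_simps power_numeral_reduce)
    also have "\<dots> > 0" using r(1) by (simp add: add_pos_nonneg)
    finally show ?thesis .
  qed
  ultimately show False by simp
qed

lemma spectral_bound_bipartite:
  fixes n t :: real
  assumes n: "6 \<le> n" and t: "(t\<^sup>2 - 1)\<^sup>2 \<le> 2 * n\<^sup>2 - 15 * n + 52"
  shows "t\<^sup>2 < n\<^sup>2 \<and> t\<^sup>2 \<le> 3 / (2 * n) * (n\<^sup>2 - t\<^sup>2)"
proof -
  \<comment> \<open>This is the second claim with denominators cleared. Subtracting
    \<open>2 * n + 3\<close> from both sides exposes \<open>t\<^sup>2 - 1\<close>, so squaring
    brings in the hypothesis.\<close>
  have le: "t\<^sup>2 * (2 * n + 3) \<le> 3 * n\<^sup>2"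
  proof (rule ccontr)
    assume "\<not> t\<^sup>2 * (2 * n + 3) \<le> 3 * n\<^sup>2"
    then have gt: "3 * n\<^sup>2 - (2 * n + 3) < (t\<^sup>2 - 1) * (2 * n + 3)" by (simp add: algebra_simps)
    \<comment> \<open>Shifting to the smallest admissible order turns the polynomial inequalities
      into ones with positive coefficients; the estimates that follow use the same device.\<close>
    define m where "m = n - 6"
    have m: "0 \<le> m" "n = m + 6" using n by (auto simp: m_def)
    have pos: "0 \<le> 3 * n\<^sup>2 - (2 * n + 3)"
      unfolding m(2) using m(1) by (simp add: power2_eq_square algebra_simps)
    have "(3 * n\<^sup>2 - (2 * n + 3))\<^sup>2 < ((t\<^sup>2 - 1) * (2 * n + 3))\<^sup>2"
      using gt pos by (intro power_strict_mono) auto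
    also have "\<dots> \<le> (2 * n\<^sup>2 - 15 * n + 52) * (2 * n + 3)\<^sup>2"
      unfolding power_mult_distrib using t by (intro mult_right_mono) auto
    finally have "(3 * n\<^sup>2 - (2 * n + 3))\<^sup>2 < (2 * n\<^sup>2 - 15 * n + 52) * (2 * n + 3)\<^sup>2" .
    moreover have "(2 * n\<^sup>2 - 15 * n + 52) * (2 * n + 3)\<^sup>2 \<le> (3 * n\<^sup>2 - (2 * n + 3))\<^sup>2"
      unfolding m(2) using m(1) by (simp add: power_numeral_reduce algebra_simps)
    ultimately show False by simp
  qed
  have "t\<^sup>2 * (2 * n + 3) < n\<^sup>2 * (2 * n + 3)"
    using le n by (intro le_less_trans[OF le]) (auto intro!: mult_strict_left_mono simp: mult.commute)
  then have "t\<^sup>2 < n\<^sup>2" using n by simp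
  moreover have "t\<^sup>2 \<le> 3 / (2 * n) * (n\<^sup>2 - t\<^sup>2)"
    using le n by (simp add: field_simps)
  ultimately show ?thesis by simp
qed

text \<open>
  The denominators are the values at \<open>n\<close> of the polynomials \<open>x ^ 5 - n x ^ 3 - 2 x ^ 2 + (n - 3) x\<close>
  and \<open>x ^ 5 - n x ^ 3 + (2 n - 8) x\<close>, which annihilate the spectra of the extremal graphs.
\<close>

definition X_energy :: "real \<Rightarrow> real" where
  "X_energy n = (n ^ 5 - n ^ 4 + 2 * n ^ 3 - n ^ 2 - n + 12) / (n ^ 5 - n ^ 4 - n ^ 2 - 3 * n)"

definition X_tilde_energy :: "real \<Rightarrow> real" where
  "X_tilde_energy n =
     (n ^ 5 - n ^ 4 + 2 * n ^ 3 + 2 * n ^ 2 - 16 * n + 32) / (n ^ 5 - n ^ 4 + 2 * n ^ 2 - 8 * n)"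

lemma X_denominator_pos: "4 \<le> n \<Longrightarrow> 0 < n ^ 5 - n ^ 4 - n ^ 2 - 3 * (n :: real)"
proof -
  assume n: "4 \<le> n"
  define m where "m = n - 4"
  have m: "0 \<le> m" "n = m + 4" using n by (auto simp: m_def)
  have "n ^ 5 - n ^ 4 - n ^ 2 - 3 * n = 740 + 1013 * m + 543 * m ^ 2 + 144 * m ^ 3 + 19 * m ^ 4 + m ^ 5"
    unfolding m(2) by Groebner_Basis.algebra
  also have "\<dots> > 0" using m(1) by (simp add: add_pos_nonneg)
  finally show ?thesis .
qed

lemma X_tilde_denominator_pos: "4 \<le> n \<Longrightarrow> 0 < n ^ 5 - n ^ 4 + 2 * n ^ 2 - 8 * (n :: real)"
proof -
  assume n: "4 \<le> n"
  define m where "m = n - 4"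
  have m: "0 \<le> m" "n = m + 4" using n by (auto simp: m_def)
  have "n ^ 5 - n ^ 4 + 2 * n ^ 2 - 8 * n = 768 + 1032 * m + 546 * m ^ 2 + 144 * m ^ 3 + 19 * m ^ 4 + m ^ 5"
    unfolding m(2) by Groebner_Basis.algebra
  also have "\<dots> > 0" using m(1) by (simp add: add_pos_nonneg)
  finally show ?thesis .
qed

text \<open>The surplus at order \<open>1 / n ^ 4\<close> is
  \<open>4 + 2 - 2 * (9 / 4) = 3 / 2\<close>; times the cleared factor 4 it is the leading
  coefficient 6 of the polynomial in \<open>m\<close>.\<close>

lemma triangle_bound_less_X_energy:
  fixes n M :: real
  assumes n: "5 \<le> n" and M: "M \<le> 2 * n\<^sup>2 - 8 * n + 28"
  shows "1 + 2 / n ^ 2 + 6 / n ^ 4 + (1 / n ^ 5 + (9 / 4) / n ^ 6) * M + 10 * n / n ^ 6 < X_energy n"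
proof -
  define m where "m = n - 5"
  have m: "0 \<le> m" "n = m + 5" using n by (auto simp: m_def)
  let ?M = "2 * n\<^sup>2 - 8 * n + 28" and ?d = "n ^ 5 - n ^ 4 - n ^ 2 - 3 * n"
  let ?num = "n ^ 5 - n ^ 4 + 2 * n ^ 3 - n ^ 2 - n + 12"
  let ?A = "4 * n ^ 6 + 8 * n ^ 4 + 24 * n ^ 2 + (4 * n + 9) * ?M + 40 * n"
  have "(1 / n ^ 5 + (9 / 4) / n ^ 6) * M \<le> (1 / n ^ 5 + (9 / 4) / n ^ 6) * ?M"
    using M n by (intro mult_left_mono) auto
  moreover have "1 + 2 / n ^ 2 + 6 / n ^ 4 + (1 / n ^ 5 + (9 / 4) / n ^ 6) * ?M + 10 * n / n ^ 6 = ?A / (4 * n ^ 6)"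
    using n by (simp add: field_simps power_numeral_reduce)
  ultimately have "1 + 2 / n ^ 2 + 6 / n ^ 4 + (1 / n ^ 5 + (9 / 4) / n ^ 6) * M + 10 * n / n ^ 6 \<le>
      ?A / (4 * n ^ 6)"
    by linarith
  also have "\<dots> < X_energy n"
  proof -
    have "?num * (4 * n ^ 6) - ?A * ?d = 21080 + 113176 * m + 132542 * m ^ 2 + 67080 * m ^ 3
        + 17786 * m ^ 4 + 2590 * m ^ 5 + 196 * m ^ 6 + 6 * m ^ 7"
      unfolding m(2) by Groebner_Basis.algebra
    also have "\<dots> > 0" using m(1) by (simp add: add_pos_nonneg)
    finally show ?thesis
      using n X_denominator_pos[of n] by (simp add: X_energy_def divide_less_eq less_divide_eq field_simps)
  qed
  finally show ?thesis .
qed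

text \<open>Here the missing triangle enters as well: the surplus is
  \<open>6 + 4 + 2 - 2 * (7 / 2) = 5\<close>, which doubled is the leading coefficient 10.\<close>

lemma triangle_free_bound_less_X_energy:
  fixes n M :: real
  assumes n: "4 \<le> n" and M: "M \<le> 2 * n\<^sup>2 - 8 * n + 32"
  shows "1 + 2 / n ^ 2 + (1 / n ^ 5 + (7 / 2) / n ^ 6) * M + 10 * n / n ^ 6 < X_energy n"
proof -
  define m where "m = n - 4"
  have m: "0 \<le> m" "n = m + 4" using n by (auto simp: m_def)
  let ?M = "2 * n\<^sup>2 - 8 * n + 32" and ?d = "n ^ 5 - n ^ 4 - n ^ 2 - 3 * n"
  let ?num = "n ^ 5 - n ^ 4 + 2 * n ^ 3 - n ^ 2 - n + 12"
  let ?A = "2 * n ^ 6 + 4 * n ^ 4 + (2 * n + 7) * ?M + 20 * n"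
  have "(1 / n ^ 5 + (7 / 2) / n ^ 6) * M \<le> (1 / n ^ 5 + (7 / 2) / n ^ 6) * ?M"
    using M n by (intro mult_left_mono) auto
  moreover have "1 + 2 / n ^ 2 + (1 / n ^ 5 + (7 / 2) / n ^ 6) * ?M + 10 * n / n ^ 6 = ?A / (2 * n ^ 6)"
    using n by (simp add: field_simps power_numeral_reduce)
  ultimately have "1 + 2 / n ^ 2 + (1 / n ^ 5 + (7 / 2) / n ^ 6) * M + 10 * n / n ^ 6 \<le>
      ?A / (2 * n ^ 6)"
    by linarith
  also have "\<dots> < X_energy n"
  proof -
    have "?num * (2 * n ^ 6) - ?A * ?d = 40256 + 108128 * m + 115196 * m ^ 2 + 62006 * m ^ 3
        + 18554 * m ^ 4 + 3132 * m ^ 5 + 278 * m ^ 6 + 10 * m ^ 7"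
      unfolding m(2) by Groebner_Basis.algebra
    also have "\<dots> > 0" using m(1) by (simp add: add_pos_nonneg)
    finally show ?thesis
      using n X_denominator_pos[of n] by (simp add: X_energy_def divide_less_eq less_divide_eq field_simps)
  qed
  finally show ?thesis .
qed

text \<open>The surplus is \<open>4 + 2 - 2 * (3 / 2) = 3\<close>, which doubled is the leading
  coefficient 6.\<close>

lemma bipartite_bound_less_X_tilde_energy:
  fixes n M :: real
  assumes n: "6 \<le> n" and M: "M \<le> 2 * n\<^sup>2 - 12 * n + 52"
  shows "1 + 2 / n ^ 2 + (1 + 3 / (2 * n)) / n ^ 5 * M < X_tilde_energy n"
proof -
  define m where "m = n - 6"
  have m: "0 \<le> m" "n = m + 6" using n by (auto simp: m_def)
  let ?M = "2 * n\<^sup>2 - 12 * n + 52" and ?d = "n ^ 5 - n ^ 4 + 2 * n ^ 2 - 8 * n"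
  let ?num = "n ^ 5 - n ^ 4 + 2 * n ^ 3 + 2 * n ^ 2 - 16 * n + 32"
  let ?A = "2 * n ^ 6 + 4 * n ^ 4 + (2 * n + 3) * ?M"
  have "(1 + 3 / (2 * n)) / n ^ 5 * M \<le> (1 + 3 / (2 * n)) / n ^ 5 * ?M"
    using M n by (intro mult_left_mono) auto
  moreover have "1 + 2 / n ^ 2 + (1 + 3 / (2 * n)) / n ^ 5 * ?M = ?A / (2 * n ^ 6)"
    using n by (simp add: field_simps power_numeral_reduce)
  ultimately have "1 + 2 / n ^ 2 + (1 + 3 / (2 * n)) / n ^ 5 * M \<le> ?A / (2 * n ^ 6)"
    by linarith
  also have "\<dots> < X_tilde_energy n"
  proof -
    have "?num * (2 * n ^ 6) - ?A * ?d = 27936 + 312480 * m + 301912 * m ^ 2 + 124616 * m ^ 3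
        + 27464 * m ^ 4 + 3392 * m ^ 5 + 222 * m ^ 6 + 6 * m ^ 7"
      unfolding m(2) by Groebner_Basis.algebra
    also have "\<dots> > 0" using m(1) by (simp add: add_pos_nonneg)
    finally show ?thesis
      using n X_tilde_denominator_pos[of n]
      by (simp add: X_tilde_energy_def divide_less_eq less_divide_eq field_simps)
  qed
  finally show ?thesis .
qed

section \<open>Adjacency matrices and isomorphisms\<close>

sublocale pair_graph \<subseteq> sg: simple_adjacency "\<lambda>x y. (x, y) \<in> parcs G"
proof
  fix x y assume "(x, y) \<in> parcs G"
  then show "(y, x) \<in> parcs G" using pair_sym_arcs by (auto simp: symmetric_def dest: symD)
next
  show "(x, x) \<notin> parcs G" for x using pair_no_loops by fastforce
qed

context pair_graph
begin

lemma card_parcs: "card (parcs G) = 2 * card (uedges G)"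
proof -
  define f where "f e = {fst e, snd e}" for e :: "'a \<times> 'a"
  have im: "uedges G = f ` parcs G" by (force simp: uedges_def f_def)
  have "card (parcs G) = (\<Sum>e\<in>uedges G. card {a \<in> parcs G. f a = e})"
    using pair_finite_arcs unfolding im by (subst card_eq_sum, subst sum.image_gen[of _ _ f]) auto
  also have "\<dots> = (\<Sum>e\<in>uedges G. 2)"
  proof (rule sum.cong)
    fix e assume "e \<in> uedges G"
    then obtain u v where e: "e = {u, v}" "(u, v) \<in> parcs G" by (auto simp: uedges_def)
    then have "u \<noteq> v" using sg.adj_irrefl by auto
    moreover have "{a \<in> parcs G. f a = e} = {(u, v), (v, u)}"
      using e sg.adj_sym by (auto simp: f_def doubleton_eq_iff)
    ultimately show "card {a \<in> parcs G. f a = e} = 2" by simp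
  qed simp
  finally show ?thesis by simp
qed

lemma sum_deg_eq_card_parcs: "(\<Sum>x\<in>pverts G. sg.deg (pverts G) x) = card (parcs G)"
proof -
  have "(\<Sum>x\<in>pverts G. sg.deg (pverts G) x) =
      card (SIGMA x:pverts G. {y \<in> pverts G. (x, y) \<in> parcs G})"
    unfolding sg.deg_def using pair_finite_verts by simp
  also have "(SIGMA x:pverts G. {y \<in> pverts G. (x, y) \<in> parcs G}) = parcs G"
    by (auto dest: in_arcsD1 in_arcsD2)
  finally show ?thesis .
qed

lemma unicyclic_imp_unicyclic_on:
  assumes "unicyclic G"
  shows "sg.unicyclic_on (pverts G)"
  unfolding sg.unicyclic_on_def
proof (intro conjI allI impI)
  have con: "strongly_connected (with_proj (mk_symmetric (with_proj G)))"
    using assms by (simp add: unicyclic_def Digraph_Component.connected_def)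
  show "finite (pverts G)" by (rule pair_finite_verts)
  show "pverts G \<noteq> {}" using con by (simp add: strongly_connected_def)
  show "(\<Sum>x\<in>pverts G. sg.deg (pverts G) x) = 2 * card (pverts G)"
    using assms by (simp add: sum_deg_eq_card_parcs card_parcs unicyclic_def)
  fix S assume S: "S \<subseteq> pverts G" "S \<noteq> {}" "\<forall>x\<in>S. \<forall>y\<in>pverts G. (x, y) \<in> parcs G \<longrightarrow> y \<in> S"
  then obtain u where u: "u \<in> S" by blast
  have "v \<in> S" if v: "v \<in> pverts G" for v
  proof -
    have "u \<rightarrow>\<^sup>*\<^bsub>with_proj (mk_symmetric (with_proj G))\<^esub> v"
      using con u v S by (auto simp: strongly_connected_def)
    then have "(u, v) \<in> rtrancl_on (pverts G) (parcs G)"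
      unfolding reachable_mk_symmetric_eq[OF pair_sym_arcs] by (simp add: reachable_def)
    then show ?thesis
      by (induction rule: rtrancl_on_induct) (use u S in auto)
  qed
  then show "S = pverts G" using S by blast
qed

text \<open>Matrices given by functions on vertices: products and traces become sums over
  \<open>pverts G\<close>, and the enumeration disappears from the computations.\<close>

definition vmat :: "('a \<Rightarrow> 'a \<Rightarrow> real) \<Rightarrow> real mat" where
  "vmat w = mat (card (pverts G)) (card (pverts G))
     (\<lambda>(i, j). w (from_nat_into (pverts G) i) (from_nat_into (pverts G) j))"

lemma bij_enum: "bij_betw (from_nat_into (pverts G)) {..<card (pverts G)} (pverts G)"
  by (rule bij_betw_from_nat_into_finite[OF pair_finite_verts])

lemma sum_enum: "(\<Sum>i<card (pverts G). g (from_nat_into (pverts G) i)) = (\<Sum>x\<in>pverts G. g x)"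
  by (rule sum.reindex_bij_betw[OF bij_enum])

lemma vmat_carrier: "vmat w \<in> carrier_mat (card (pverts G)) (card (pverts G))"
  by (simp add: vmat_def)

lemma vmat_mult: "vmat w * vmat w' = vmat (\<lambda>x y. \<Sum>z\<in>pverts G. w x z * w' z y)"
  by (rule eq_matI)
     (simp_all add: vmat_def scalar_prod_def atLeast0LessThan sum_enum[where g = "\<lambda>z. w _ z * w' z _"])

lemma trace_vmat: "trace_mat (vmat w) = (\<Sum>x\<in>pverts G. w x x)"
  by (simp add: trace_mat_def vmat_def sum_enum[where g = "\<lambda>x. w x x"])

lemma adj_mat_eq_vmat: "adj_mat G = vmat sg.adj"
  by (rule eq_matI) (auto simp: adj_mat_def adj_mat_wrt_def vmat_def sg.adj_def)

lemma adj_mat_carrier: "adj_mat G \<in> carrier_mat (card (pverts G)) (card (pverts G))"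
  by (simp add: adj_mat_eq_vmat vmat_carrier)

lemma size_proots_adj_mat: "size (proots (char_poly (adj_mat G))) = card (pverts G)"
  using size_adj_eigenvalues[OF pair_graph] by (simp add: adj_eigenvalues_def)

lemma power_sum_trace: "power_sum (adj_eigenvalues G) k = trace_mat (adj_mat G ^\<^sub>m k)"
  unfolding power_sum_def adj_eigenvalues_def
  by (rule sum_proots_power[OF adj_mat_carrier size_proots_adj_mat])

text \<open>The fourth and fifth matrix powers are split as \<open>2 + 2\<close> and
  \<open>2 + 3\<close>, matching the shape of \<open>mom4\<close> and \<open>mom5\<close>.\<close>

lemma power_sums:
  "power_sum (adj_eigenvalues G) 1 = 0"
  "power_sum (adj_eigenvalues G) 2 = card (parcs G)"
  "power_sum (adj_eigenvalues G) 3 = sg.mom3 (pverts G)"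
  "power_sum (adj_eigenvalues G) 4 = sg.mom4 (pverts G)"
  "power_sum (adj_eigenvalues G) 5 = sg.mom5 (pverts G)"
proof -
  let ?A = "adj_mat G" and ?V = "pverts G"
  note A = adj_mat_carrier
  have A1: "?A ^\<^sub>m 1 = vmat sg.adj" using A by (simp add: adj_mat_eq_vmat vmat_def)
  have A2: "?A ^\<^sub>m 2 = vmat (sg.walk2 ?V)"
    using A1 by (simp add: numeral_2_eq_2 adj_mat_eq_vmat vmat_mult sg.walk2_def[abs_def])
  have A3: "?A ^\<^sub>m 3 = vmat (sg.walk3 ?V)"
  proof -
    have "?A ^\<^sub>m 3 = ?A ^\<^sub>m 2 * ?A" by (simp add: numeral_3_eq_3 numeral_2_eq_2)
    also have "\<dots> = vmat (\<lambda>x y. sg.walk3 ?V x y)"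
      by (subst A2) (simp only: adj_mat_eq_vmat vmat_mult flip: sg.walk3_alt)
    finally show ?thesis .
  qed
  have A4: "?A ^\<^sub>m 4 = ?A ^\<^sub>m 2 * ?A ^\<^sub>m 2"
    using A by (simp add: numeral_eq_Suc assoc_mult_mat[of _ "card ?V" "card ?V" _ "card ?V" _ "card ?V"])
  have A5: "?A ^\<^sub>m 5 = ?A ^\<^sub>m 2 * ?A ^\<^sub>m 3"
    using A by (simp add: numeral_eq_Suc assoc_mult_mat[of _ "card ?V" "card ?V" _ "card ?V" _ "card ?V"])
  show "power_sum (adj_eigenvalues G) 1 = 0"
    unfolding power_sum_trace A1 trace_vmat by simp
  show "power_sum (adj_eigenvalues G) 2 = card (parcs G)"
    unfolding power_sum_trace A2 trace_vmat
    using sum_deg_eq_card_parcs by (simp add: sg.walk2_self[OF pair_finite_verts] flip: of_nat_sum)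
  show "power_sum (adj_eigenvalues G) 3 = sg.mom3 ?V"
    unfolding power_sum_trace A3 trace_vmat sg.mom3_def ..
  show "power_sum (adj_eigenvalues G) 4 = sg.mom4 ?V"
    unfolding power_sum_trace A4 A2 vmat_mult trace_vmat sg.mom4_def power2_eq_square
    by (simp add: sg.walk2_commute)
  show "power_sum (adj_eigenvalues G) 5 = sg.mom5 ?V"
    unfolding power_sum_trace A5 A2 A3 vmat_mult trace_vmat sg.mom5_def
    by (simp add: sg.walk3_commute)
qed

lemma eigenvalue_equations:
  assumes "t \<in># adj_eigenvalues G"
  obtains y where "\<exists>x\<in>pverts G. y x \<noteq> 0"
    "\<forall>x\<in>pverts G. (\<Sum>z\<in>pverts G. sg.adj x z * y z) = t * y x"
proof -
  let ?A = "adj_mat G" and ?V = "pverts G" and ?f = "from_nat_into (pverts G)"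
  define n where "n = card ?V"
  note A = adj_mat_carrier[folded n_def]
  have "char_poly ?A \<noteq> 0" using degree_monic_char_poly[OF A] by auto
  then have "poly (char_poly ?A) t = 0" using assms by (simp add: adj_eigenvalues_def)
  then obtain v where "eigenvector ?A v t"
    using eigenvalue_root_char_poly[OF A] by (auto simp: eigenvalue_def)
  then have v: "v \<in> carrier_vec n" "v \<noteq> 0\<^sub>v n" "?A *\<^sub>v v = t \<cdot>\<^sub>v v"
    using A by (auto simp: eigenvector_def)
  define y where "y x = v $ (the_inv_into {..<n} ?f x)" for x
  have yf: "y (?f i) = v $ i" if "i < n" for i
    using bij_enum that by (simp add: y_def n_def bij_betw_def the_inv_into_f_f)
  have ex: "\<exists>i<n. ?f i = x" if "x \<in> ?V" for x
  proof -
    have "x \<in> ?f ` {..<n}" using bij_enum that by (simp add: bij_betw_def n_def)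
    then show ?thesis by auto
  qed
  have "\<exists>i<n. v $ i \<noteq> 0" using v by (auto simp: vec_eq_iff)
  then obtain i where i: "i < n" "v $ i \<noteq> 0" by blast
  moreover have "?f i \<in> ?V" using bij_enum i by (auto simp: bij_betw_def n_def)
  ultimately have "\<exists>x\<in>?V. y x \<noteq> 0" using yf by metis
  moreover have "(\<Sum>z\<in>?V. sg.adj x z * y z) = t * y x" if x: "x \<in> ?V" for x
  proof -
    obtain i where i: "i < n" "?f i = x" using ex[OF x] by blast
    have "t * y x = (?A *\<^sub>v v) $ i" using i v yf by auto
    also have "\<dots> = (\<Sum>j<n. sg.adj x (?f j) * v $ j)"
      using i v(1) by (simp add: scalar_prod_def atLeast0LessThan adj_mat_eq_vmat vmat_def n_def)
    also have "\<dots> = (\<Sum>j<n. sg.adj x (?f j) * y (?f j))" using yf by simp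
    also have "\<dots> = (\<Sum>z\<in>?V. sg.adj x z * y z)"
      unfolding n_def by (rule sum_enum[where g = "\<lambda>z. sg.adj x z * y z"])
    finally show ?thesis by simp
  qed
  ultimately show ?thesis using that by blast
qed

text \<open>Conjugation by the diagonal matrix \<open>D\<close> of signs, 1 on one side and -1 on
  the other, negates the adjacency matrix because every edge joins opposite signs.\<close>

lemma bipartite_symmetric_spectrum:
  assumes "bipartite G"
  shows "image_mset uminus (adj_eigenvalues G) = adj_eigenvalues G"
proof -
  obtain S T where ST: "pverts G = S \<union> T" "S \<inter> T = {}" "parcs G \<subseteq> S \<times> T \<union> T \<times> S"
    using assms by (auto simp: bipartite_def)
  define s where "s x = (if x \<in> S then 1 else - 1 :: real)" for x
  define D where "D = vmat (\<lambda>x y. of_bool (x = y) * s x)"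
  have s2: "s x * s x = 1" for x by (simp add: s_def)
  have I: "vmat (\<lambda>x y. of_bool (x = y)) = 1\<^sub>m (card (pverts G))"
    using bij_enum by (intro eq_matI) (auto simp: vmat_def bij_betw_def dest: inj_onD)
  have collapse: "(\<Sum>z\<in>pverts G. of_bool (x = z) * s x * h z) = s x * h x" if "x \<in> pverts G" for x h
  proof -
    have "(\<Sum>z\<in>pverts G. of_bool (x = z) * s x * h z) = (\<Sum>z\<in>pverts G. if z = x then s x * h x else 0)"
      by (intro sum.cong) auto
    then show ?thesis using that pair_finite_verts by simp
  qed
  have collapse': "(\<Sum>z\<in>pverts G. h z * (of_bool (z = x) * s z)) = h x * s x" if "x \<in> pverts G" for x h
  proof -
    have "(\<Sum>z\<in>pverts G. h z * (of_bool (z = x) * s z)) = (\<Sum>z\<in>pverts G. if z = x then h x * s x else 0)"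
      by (intro sum.cong) auto
    then show ?thesis using that pair_finite_verts by simp
  qed
  have cong: "vmat w = vmat w'" if "\<And>x y. x \<in> pverts G \<Longrightarrow> y \<in> pverts G \<Longrightarrow> w x y = w' x y" for w w'
    using bij_enum that by (intro eq_matI) (auto simp: vmat_def bij_betw_def)
  have DD: "D * D = 1\<^sub>m (card (pverts G))"
    unfolding D_def vmat_mult I[symmetric]
    by (rule cong) (auto simp: collapse s2)
  have neg: "(- 1) \<cdot>\<^sub>m adj_mat G = vmat (\<lambda>x y. - sg.adj x y)"
    by (rule eq_matI) (auto simp: adj_mat_eq_vmat vmat_def)
  have "D * ((- 1) \<cdot>\<^sub>m adj_mat G) * D = adj_mat G"
    unfolding neg unfolding D_def vmat_mult adj_mat_eq_vmat
  proof (rule cong)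
    fix x y assume xy: "x \<in> pverts G" "y \<in> pverts G"
    have row: "(\<Sum>w\<in>pverts G. of_bool (x = w) * s x * - sg.adj w z) = s x * - sg.adj x z" for z
      by (rule collapse[OF xy(1)])
    have "(\<Sum>z\<in>pverts G. (\<Sum>w\<in>pverts G. of_bool (x = w) * s x * - sg.adj w z) * (of_bool (z = y) * s z))
      = (\<Sum>z\<in>pverts G. (s x * - sg.adj x z) * (of_bool (z = y) * s z))"
      by (simp only: row)
    also have "\<dots> = s x * - sg.adj x y * s y"
      by (rule collapse'[OF xy(2)])
    also have "\<dots> = sg.adj x y" using ST xy by (auto simp: sg.adj_def s_def)
    finally show "(\<Sum>z\<in>pverts G. (\<Sum>w\<in>pverts G. of_bool (x = w) * s x * - sg.adj w z) *
      (of_bool (z = y) * s z)) = sg.adj x y" .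
  qed
  then have "similar_mat (adj_mat G) ((- 1) \<cdot>\<^sub>m adj_mat G)"
    using DD adj_mat_carrier vmat_carrier
    by (intro similar_matI[of _ _ D D "card (pverts G)"]) (auto simp: D_def)
  then show ?thesis
    unfolding adj_eigenvalues_def
    by (rule proots_symmetric[OF adj_mat_carrier size_proots_adj_mat])
qed

end

lemma digraph_isoI:
  assumes G: "pair_graph G" and H: "pair_graph H" and h: "bij_betw h (pverts G) (pverts H)"
    and E: "\<And>x y. x \<in> pverts G \<Longrightarrow> y \<in> pverts G \<Longrightarrow> (x, y) \<in> parcs G \<longleftrightarrow> (h x, h y) \<in> parcs H"
  shows "digraph_iso (with_proj G) (with_proj H)"
proof -
  interpret G: pair_graph G by fact
  interpret H: pair_graph H by fact
  define f where "f = \<lparr>iso_verts = h, iso_arcs = map_prod h h, iso_head = snd, iso_tail = fst\<rparr>"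
  have inj: "inj_on h (pverts G)" and im: "h ` pverts G = pverts H" using h by (auto simp: bij_betw_def)
  have sub: "parcs G \<subseteq> pverts G \<times> pverts G" by (auto dest: G.in_arcsD1 G.in_arcsD2)
  have "inj_on (map_prod h h) (parcs G)"
    by (rule inj_on_subset[OF map_prod_inj_on[OF inj inj] sub])
  then have "pre_digraph.digraph_isomorphism (with_proj G) f"
    using inj G.wf_digraph_axioms by (auto simp: pre_digraph.digraph_isomorphism_def f_def)
  moreover have "parcs H = map_prod h h ` parcs G"
  proof (intro equalityI subsetI)
    fix e assume e: "e \<in> parcs H"
    obtain a b where ab: "e = (a, b)" by (cases e)
    then have "a \<in> h ` pverts G" "b \<in> h ` pverts G"
      using e im by (auto dest: H.in_arcsD1 H.in_arcsD2)
    then obtain x y where "x \<in> pverts G" "y \<in> pverts G" "a = h x" "b = h y" by auto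
    then show "e \<in> map_prod h h ` parcs G" using e ab E[of x y] by force
  next
    fix e assume "e \<in> map_prod h h ` parcs G"
    then show "e \<in> parcs H" using E sub by auto
  qed
  then have "with_proj H = app_iso f (with_proj G)"
    using im by (simp add: app_iso_def f_def with_proj_def)
  ultimately show ?thesis unfolding digraph_iso_def by blast
qed

lemma digraph_isoE:
  assumes G: "pair_graph G" and H: "pair_graph H" and iso: "digraph_iso (with_proj G) (with_proj H)"
  obtains h where "bij_betw h (pverts G) (pverts H)"
    "\<And>x y. x \<in> pverts G \<Longrightarrow> y \<in> pverts G \<Longrightarrow> (x, y) \<in> parcs G \<longleftrightarrow> (h x, h y) \<in> parcs H"
proof -
  interpret G: pair_graph G by fact
  obtain f where f: "pre_digraph.digraph_isomorphism (with_proj G) f"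
    "with_proj H = app_iso f (with_proj G)"
    using iso by (auto simp: digraph_iso_def)
  define h where "h = iso_verts f"
  have inj: "inj_on h (pverts G)" using f(1) by (simp add: pre_digraph.digraph_isomorphism_def h_def)
  have vH: "pverts H = h ` pverts G"
    using arg_cong[OF f(2), of verts] by (simp add: h_def)
  have aH: "parcs H = iso_arcs f ` parcs G"
    using arg_cong[OF f(2), of arcs] by simp
  have "fst = iso_tail f" "snd = iso_head f"
    using arg_cong[OF f(2), of tail] arg_cong[OF f(2), of head] by simp_all
  then have arc: "iso_arcs f e = map_prod h h e" if "e \<in> parcs G" for e
    using f(1) that by (auto simp: pre_digraph.digraph_isomorphism_def h_def prod_eq_iff)
  have aH: "parcs H = map_prod h h ` parcs G" unfolding aH using arc by (rule image_cong[OF refl])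
  have "(x, y) \<in> parcs G \<longleftrightarrow> (h x, h y) \<in> parcs H" if xy: "x \<in> pverts G" "y \<in> pverts G" for x y
  proof
    assume "(h x, h y) \<in> parcs H"
    then obtain a b where ab: "(a, b) \<in> parcs G" "h x = h a" "h y = h b" by (auto simp: aH)
    moreover from this have "a \<in> pverts G" "b \<in> pverts G" by (auto dest: G.in_arcsD1 G.in_arcsD2)
    ultimately have "x = a" "y = b" using xy by (auto dest: inj_onD[OF inj])
    then show "(x, y) \<in> parcs G" using ab by simp
  qed (force simp: aH)
  then show ?thesis using that inj vH by (auto simp: bij_betw_def)
qed

text \<open>Composing the enumeration of \<open>G\<close> with the isomorphism enumerates
  \<open>H\<close> with literally the same matrix, and the characteristic polynomial does not depend
  on the enumeration.\<close>

lemma resolvent_energy_iso: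
  assumes G: "pair_graph G" and H: "pair_graph H" and iso: "digraph_iso (with_proj G) (with_proj H)"
  shows "resolvent_energy G = resolvent_energy H"
proof -
  interpret G: pair_graph G by fact
  interpret H: pair_graph H by fact
  obtain h where h: "bij_betw h (pverts G) (pverts H)"
    "\<And>x y. x \<in> pverts G \<Longrightarrow> y \<in> pverts G \<Longrightarrow> (x, y) \<in> parcs G \<longleftrightarrow> (h x, h y) \<in> parcs H"
    using digraph_isoE[OF assms] by blast
  let ?f = "from_nat_into (pverts G)"
  have c: "card (pverts H) = card (pverts G)" using h(1) by (metis bij_betw_same_card)
  have "?f i \<in> pverts G" if "i < card (pverts G)" for i
    using G.bij_enum that by (auto simp: bij_betw_def)
  then have "adj_mat_wrt (h \<circ> ?f) H = adj_mat G"
    using h(2) by (intro eq_matI) (auto simp: adj_mat_wrt_def adj_mat_def c)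
  moreover have "bij_betw (h \<circ> ?f) {..<card (pverts H)} (pverts H)"
    unfolding c by (rule bij_betw_trans[OF G.bij_enum h(1)])
  ultimately have "char_poly (adj_mat G) = char_poly (adj_mat H)"
    using char_poly_adj_mat_wrt[OF H.pair_finite_verts] by metis
  then show ?thesis by (simp add: resolvent_energy_def adj_eigenvalues_def c)
qed

section \<open>The extremal graphs\<close>

lemma X_graph_pair_graph: "3 \<le> n \<Longrightarrow> pair_graph (X_graph n)"
  by (simp add: X_graph_def pair_graph_cycle_pendants)

lemma X_tilde_graph_pair_graph: "4 \<le> n \<Longrightarrow> pair_graph (X_tilde_graph n)"
  by (simp add: X_tilde_graph_def pair_graph_cycle_pendants)

lemma pverts_X_graph [simp]: "pverts (X_graph n) = {..<n}"
  by (simp add: X_graph_def cycle_pendants_def Let_def)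

lemma pverts_X_tilde_graph [simp]: "pverts (X_tilde_graph n) = {..<n}"
  by (simp add: X_tilde_graph_def cycle_pendants_def Let_def)

lemma parcs_X_graph:
  assumes "3 \<le> n"
  shows "(x, y) \<in> parcs (X_graph n) \<longleftrightarrow>
    x < n \<and> y < n \<and> (x = 0 \<and> y \<noteq> 0 \<or> y = 0 \<and> x \<noteq> 0 \<or> x = 1 \<and> y = 2 \<or> x = 2 \<and> y = 1)"
proof -
  have s: "Suc 0 mod 3 = 1" "Suc 1 mod 3 = 2" "Suc 2 mod 3 = 0" by simp_all
  have "{..<3} = ({0, 1, 2} :: nat set)" by auto
  moreover have "{(i, Suc i mod 3) | i. i < 3} = (\<lambda>i. (i, Suc i mod 3)) ` {..<3}" by blast
  ultimately have E: "{(i, Suc i mod 3) | i. i < 3} = {(0, 1), (1, 2), (2, 0)}"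
    by (simp only: image_insert image_empty s)
  show ?thesis
    using assms unfolding X_graph_def cycle_pendants_def Let_def E by auto
qed

lemma parcs_X_tilde_graph:
  assumes "4 \<le> n"
  shows "(x, y) \<in> parcs (X_tilde_graph n) \<longleftrightarrow>
    x < n \<and> y < n \<and> (x = 0 \<and> y \<noteq> 0 \<and> y \<noteq> 2 \<or> y = 0 \<and> x \<noteq> 0 \<and> x \<noteq> 2
      \<or> x = 2 \<and> (y = 1 \<or> y = 3) \<or> y = 2 \<and> (x = 1 \<or> x = 3))"
proof -
  have s: "Suc 0 mod 4 = 1" "Suc 1 mod 4 = 2" "Suc 2 mod 4 = 3" "Suc 3 mod 4 = 0" by simp_all
  have "{..<4} = ({0, 1, 2, 3} :: nat set)" by auto
  moreover have "{(i, Suc i mod 4) | i. i < 4} = (\<lambda>i. (i, Suc i mod 4)) ` {..<4}" by blast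
  ultimately have E: "{(i, Suc i mod 4) | i. i < 4} = {(0, 1), (1, 2), (2, 3), (3, 0)}"
    by (simp only: image_insert image_empty s)
  define Q where "Q x y \<longleftrightarrow> x = 0 \<and> y = 1 \<or> x = 1 \<and> y = 2 \<or> x = 2 \<and> y = 3 \<or> x = 3 \<and> y = 0
      \<or> x = 0 \<and> 4 \<le> y \<and> y < n" for x y :: nat
  have "(x, y) \<in> parcs (X_tilde_graph n) \<longleftrightarrow> Q x y \<or> Q y x"
    unfolding X_tilde_graph_def cycle_pendants_def Let_def E Q_def by simp
  moreover have "z = 0 \<or> z = 1 \<or> z = 2 \<or> z = 3 \<or> 4 \<le> z" for z :: nat by linarith
  from this[of x] this[of y] have "Q x y \<or> Q y x \<longleftrightarrow>
      x < n \<and> y < n \<and> (x = 0 \<and> y \<noteq> 0 \<and> y \<noteq> 2 \<or> y = 0 \<and> x \<noteq> 0 \<and> x \<noteq> 2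
        \<or> x = 2 \<and> (y = 1 \<or> y = 3) \<or> y = 2 \<and> (x = 1 \<or> x = 3))"
    unfolding Q_def using assms by (elim disjE; simp)
  ultimately show ?thesis by (simp only:)
qed

lemma X_graph_card_parcs:
  assumes "3 \<le> n"
  shows "card (parcs (X_graph n)) = 2 * n"
proof -
  have "parcs (X_graph n) = ({0} \<times> {1..<n} \<union> {1..<n} \<times> {0}) \<union> {(1, 2), (2, 1)}"
    using assms by (auto simp: parcs_X_graph)
  also have "card \<dots> = (n - 1 + (n - 1)) + 2"
    by (subst card_Un_disjoint, auto)+
  finally show ?thesis using assms by simp
qed

lemma X_tilde_graph_card_parcs:
  assumes "4 \<le> n"
  shows "card (parcs (X_tilde_graph n)) = 2 * n"
proof -
  have "parcs (X_tilde_graph n) =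
    ({0} \<times> ({1..<n} - {2}) \<union> ({1..<n} - {2}) \<times> {0}) \<union> ({2} \<times> {1, 3} \<union> {1, 3} \<times> {2})"
    using assms by (auto simp: parcs_X_tilde_graph)
  also have "card \<dots> = (n - 2 + (n - 2)) + 4"
    using assms by (subst card_Un_disjoint, auto)+
  finally show ?thesis using assms by simp
qed

text \<open>For \<open>3 \<le> m \<le> n\<close> the vertices below \<open>m\<close> induce the
  extremal graph of order \<open>m\<close>, so the induction attaches pendent vertices to 0 one at a
  time within the fixed arc relation of \<open>X_graph n\<close>.\<close>

lemma X_graph_moments:
  assumes n: "3 \<le> n"
  defines "E \<equiv> \<lambda>x y. (x, y) \<in> parcs (X_graph n)"
  shows "simple_adjacency.mom3 E {..<n} = 6"
    "simple_adjacency.mom4 E {..<n} = 2 * (real n)\<^sup>2 - 4 * n + 12"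
proof -
  interpret pair_graph "X_graph n" using n by (rule X_graph_pair_graph)
  have "m \<le> n \<longrightarrow> sg.mom3 {..<m} = 6 \<and> sg.mom4 {..<m} = 2 * (real m)\<^sup>2 - 4 * m + 12" if "3 \<le> m" for m
    using that
  proof (induction m rule: dec_induct)
    case base
    have "{..<3} = {0, 1, 2 :: nat}" by auto
    then show ?case
      using sg.triangle_moments(2,3)[of "{..<3}" 0 1 2] n by (auto simp: parcs_X_graph)
  next
    case (step m)
    show ?case
    proof
      assume m: "Suc m \<le> n"
      have l: "finite {..<m}" "0 \<in> {..<m}" "m \<notin> {..<m}"
        "\<forall>y\<in>{..<m}. (m, y) \<in> parcs (X_graph n) \<longleftrightarrow> y = 0"
        using m step n by (auto simp: parcs_X_graph)
      have "{y \<in> {..<m}. (0, y) \<in> parcs (X_graph n)} = {1..<m}"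
        using m n by (auto simp: parcs_X_graph)
      then have "sg.deg {..<m} 0 = m - 1" by (simp add: sg.deg_def)
      then have d: "real (sg.deg {..<m} 0) = real m - 1" using step by simp
      show "sg.mom3 {..<Suc m} = 6 \<and> sg.mom4 {..<Suc m} = 2 * (real (Suc m))\<^sup>2 - 4 * Suc m + 12"
        unfolding lessThan_Suc sg.mom3_insert_leaf[OF l] sg.mom4_insert_leaf[OF l]
        using step.IH m d by (simp add: power2_eq_square algebra_simps)
    qed
  qed
  then show "simple_adjacency.mom3 E {..<n} = 6"
    "simple_adjacency.mom4 E {..<n} = 2 * (real n)\<^sup>2 - 4 * n + 12"
    using n by (auto simp: E_def)
qed

lemma X_tilde_graph_moments:
  assumes n: "4 \<le> n"
  defines "E \<equiv> \<lambda>x y. (x, y) \<in> parcs (X_tilde_graph n)"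
  shows "simple_adjacency.mom3 E {..<n} = 0"
    "simple_adjacency.mom4 E {..<n} = 2 * (real n)\<^sup>2 - 8 * n + 32"
proof -
  interpret pair_graph "X_tilde_graph n" using n by (rule X_tilde_graph_pair_graph)
  have "m \<le> n \<longrightarrow> sg.mom3 {..<m} = 0 \<and> sg.mom4 {..<m} = 2 * (real m)\<^sup>2 - 8 * m + 32" if "4 \<le> m" for m
    using that
  proof (induction m rule: dec_induct)
    case base
    have V: "{..<4} = {0, 1, 2, 3 :: nat}" by auto
    have a: "sg.adj 0 1 = 1" "sg.adj 0 2 = 0" "sg.adj 0 3 = 1" "sg.adj 1 0 = 1"
      "sg.adj 1 2 = 1" "sg.adj 1 3 = 0" "sg.adj 2 0 = 0" "sg.adj 2 1 = 1"
      "sg.adj 2 3 = 1" "sg.adj 3 0 = 1" "sg.adj 3 1 = 0" "sg.adj 3 2 = 1"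
      unfolding sg.adj_def using n by (simp_all add: parcs_X_tilde_graph)
    show ?case
      unfolding V sg.mom3_def sg.mom4_def sg.walk3_def sg.walk2_def
      using a by (simp del: One_nat_def)
  next
    case (step m)
    show ?case
    proof
      assume m: "Suc m \<le> n"
      have l: "finite {..<m}" "0 \<in> {..<m}" "m \<notin> {..<m}"
        "\<forall>y\<in>{..<m}. (m, y) \<in> parcs (X_tilde_graph n) \<longleftrightarrow> y = 0"
        using m step n by (auto simp: parcs_X_tilde_graph)
      have "{y \<in> {..<m}. (0, y) \<in> parcs (X_tilde_graph n)} = {1..<m} - {2}"
        using m n by (auto simp: parcs_X_tilde_graph)
      then have "sg.deg {..<m} 0 = m - 2" using step by (simp add: sg.deg_def)
      then have d: "real (sg.deg {..<m} 0) = real m - 2" using step by simp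
      show "sg.mom3 {..<Suc m} = 0 \<and> sg.mom4 {..<Suc m} = 2 * (real (Suc m))\<^sup>2 - 8 * Suc m + 32"
        unfolding lessThan_Suc sg.mom3_insert_leaf[OF l] sg.mom4_insert_leaf[OF l]
        using step.IH m d by (simp add: power2_eq_square algebra_simps)
    qed
  qed
  then show "simple_adjacency.mom3 E {..<n} = 0"
    "simple_adjacency.mom4 E {..<n} = 2 * (real n)\<^sup>2 - 8 * n + 32"
    using n by (auto simp: E_def)
qed

text \<open>The factor \<open>?q\<close> is the characteristic polynomial of the quotient by the
  classes \<open>{0}\<close>, \<open>{1, 2}\<close> and the pendent vertices; an eigenvector with
  \<open>y 0 \<noteq> 0\<close> forces \<open>?q = 0\<close>. If \<open>y 0 = 0\<close> and
  \<open>t \<noteq> 0\<close>, it lives on 1 and 2 with opposite values, so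
  \<open>t = - 1\<close>.\<close>

lemma X_graph_eigenvalue:
  assumes n: "3 \<le> n" and t: "t \<in># adj_eigenvalues (X_graph n)"
  shows "t ^ 5 + (- real n) * t ^ 3 + (- 2) * t ^ 2 + (real n - 3) * t = 0"
proof -
  interpret pair_graph "X_graph n" using n by (rule X_graph_pair_graph)
  obtain y where ne: "\<exists>x\<in>{..<n}. y x \<noteq> 0"
    and "\<forall>x\<in>{..<n}. (\<Sum>z<n. sg.adj x z * y z) = t * y x"
    using eigenvalue_equations[OF t, unfolded pverts_X_graph] .
  then have ev: "(\<Sum>z<n. sg.adj x z * y z) = t * y x" if "x < n" for x using that by blast
  have split: "(\<Sum>z<n. f z) = f 0 + f 1 + f 2 + (\<Sum>z=3..<n. f z)" for f :: "nat \<Rightarrow> real"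
  proof -
    have "{..<n} = {0, 1, 2} \<union> {3..<n}" using n by auto
    then show ?thesis by (simp add: sum.union_disjoint)
  qed
  have e0: "t * y 0 = y 1 + y 2 + (\<Sum>z=3..<n. y z)"
    using ev[of 0, unfolded sg.adj_def split] n by (simp add: parcs_X_graph)
  have e1: "t * y 1 = y 0 + y 2"
    using ev[of 1, unfolded sg.adj_def split] n by (simp add: parcs_X_graph)
  have e2: "t * y 2 = y 0 + y 1"
    using ev[of 2, unfolded sg.adj_def split] n by (simp add: parcs_X_graph)
  have ej: "t * y j = y 0" if "3 \<le> j" "j < n" for j
    using ev[of j, unfolded sg.adj_def split] that n by (simp add: parcs_X_graph)
  have "t * (\<Sum>z=3..<n. y z) = (real n - 3) * y 0"
    using n ej by (simp add: sum_distrib_left)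
  then have E0: "t * (t * y 0) = t * y 1 + t * y 2 + (real n - 3) * y 0"
    unfolding e0 by (simp add: distrib_left)
  let ?q = "t ^ 3 - t ^ 2 - (real n - 1) * t + (real n - 3)"
  have p: "t ^ 5 + (- real n) * t ^ 3 + (- 2) * t ^ 2 + (real n - 3) * t = t * (t + 1) * ?q"
    by (simp add: algebra_simps power_numeral_reduce)
  have "?q * y 0 = (t - 1) * (t * (t * y 0) - (real n - 3) * y 0) - 2 * t * y 0"
    by (simp add: algebra_simps power_numeral_reduce)
  also have "\<dots> = t * (t * y 1 + t * y 2) - (t * y 1 + t * y 2) - 2 * t * y 0"
    unfolding E0 by (simp add: algebra_simps)
  also have "\<dots> = t * (y 0 + y 2 + (y 0 + y 1)) - (t * y 1 + t * y 2) - 2 * t * y 0"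
    by (simp only: e1 e2)
  also have "\<dots> = 0" by (simp add: algebra_simps)
  finally have "?q * y 0 = 0" .
  then consider "?q = 0" | "t = 0" | "y 0 = 0" "t \<noteq> 0" by auto
  then show ?thesis
  proof cases
    case 3
    then have j: "y j = 0" if "3 \<le> j" "j < n" for j using ej that by auto
    then have "y 1 + y 2 = 0" using e0 3 by simp
    then have y2: "y 2 = - y 1" by simp
    then have "(t + 1) * y 1 = 0" using e1 3 by (simp add: algebra_simps)
    moreover have "y 1 \<noteq> 0"
    proof
      assume y1: "y 1 = 0"
      have "y x = 0" if "x < n" for x
      proof -
        consider "x = 0" | "x = 1" | "x = 2" | "3 \<le> x" by linarith
        then show ?thesis using j y1 y2 3 that by cases auto
      qed
      then show False using ne by auto
    qed
    ultimately show ?thesis unfolding p by simp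
  qed (unfold p, simp_all)
qed

text \<open>Eliminating all vertices but 0 and 2 leaves two linear equations in \<open>y 0\<close>
  and \<open>y 2\<close>, with determinant
  \<open>(t\<^sup>2 - n + 2) * (t\<^sup>2 - 2) - 4 = ?q\<close>. If both values vanish and
  \<open>t \<noteq> 0\<close>, the whole eigenvector would be zero.\<close>

lemma X_tilde_graph_eigenvalue:
  assumes n: "4 \<le> n" and t: "t \<in># adj_eigenvalues (X_tilde_graph n)"
  shows "t ^ 5 + (- real n) * t ^ 3 + 0 * t ^ 2 + (2 * real n - 8) * t = 0"
proof -
  interpret pair_graph "X_tilde_graph n" using n by (rule X_tilde_graph_pair_graph)
  obtain y where ne: "\<exists>x\<in>{..<n}. y x \<noteq> 0"
    and "\<forall>x\<in>{..<n}. (\<Sum>z<n. sg.adj x z * y z) = t * y x"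
    using eigenvalue_equations[OF t, unfolded pverts_X_tilde_graph] .
  then have ev: "(\<Sum>z<n. sg.adj x z * y z) = t * y x" if "x < n" for x using that by blast
  have split: "(\<Sum>z<n. f z) = f 0 + f 1 + f 2 + f 3 + (\<Sum>z=4..<n. f z)" for f :: "nat \<Rightarrow> real"
  proof -
    have "{..<n} = {0, 1, 2, 3} \<union> {4..<n}" using n by auto
    then show ?thesis by (simp add: sum.union_disjoint)
  qed
  have e0: "t * y 0 = y 1 + y 3 + (\<Sum>z=4..<n. y z)"
    using ev[of 0, unfolded sg.adj_def split] n by (simp add: parcs_X_tilde_graph)
  have e1: "t * y 1 = y 0 + y 2"
    using ev[of 1, unfolded sg.adj_def split] n by (simp add: parcs_X_tilde_graph)
  have e2: "t * y 2 = y 1 + y 3"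
    using ev[of 2, unfolded sg.adj_def split] n by (simp add: parcs_X_tilde_graph)
  have e3: "t * y 3 = y 0 + y 2"
    using ev[of 3, unfolded sg.adj_def split] n by (simp add: parcs_X_tilde_graph)
  have ej: "t * y j = y 0" if "4 \<le> j" "j < n" for j
    using ev[of j, unfolded sg.adj_def split] that n by (simp add: parcs_X_tilde_graph)
  have "t * (\<Sum>z=4..<n. y z) = (real n - 4) * y 0"
    using n ej by (simp add: sum_distrib_left)
  then have E0: "t * (t * y 0) = t * y 1 + t * y 3 + (real n - 4) * y 0"
    unfolding e0 by (simp add: distrib_left)
  let ?q = "t ^ 4 - real n * t ^ 2 + (2 * real n - 8)"
  have p: "t ^ 5 + (- real n) * t ^ 3 + 0 * t ^ 2 + (2 * real n - 8) * t = t * ?q"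
    by (simp add: algebra_simps power_numeral_reduce)
  have y0: "(t ^ 2 - real n + 2) * y 0 = 2 * y 2"
    using E0 unfolding e1 e3 by (simp add: algebra_simps power2_eq_square)
  have "t * (t * y 2) = t * y 1 + t * y 3" unfolding e2 by (simp add: distrib_left)
  then have y2: "(t ^ 2 - 2) * y 2 = 2 * y 0"
    unfolding e1 e3 by (simp add: algebra_simps power2_eq_square)
  have "?q * y 0 = (t ^ 2 - 2) * ((t ^ 2 - real n + 2) * y 0) - 4 * y 0"
    by (simp add: algebra_simps power_numeral_reduce)
  also have "\<dots> = 2 * ((t ^ 2 - 2) * y 2) - 4 * y 0" by (simp only: y0 mult.left_commute)
  finally have "?q * y 0 = 0" unfolding y2 by simp
  have "?q * y 2 = (t ^ 2 - real n + 2) * ((t ^ 2 - 2) * y 2) - 4 * y 2"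
    by (simp add: algebra_simps power_numeral_reduce)
  also have "\<dots> = 2 * ((t ^ 2 - real n + 2) * y 0) - 4 * y 2" by (simp only: y2 mult.left_commute)
  finally have "?q * y 2 = 0" unfolding y0 by simp
  with \<open>?q * y 0 = 0\<close> consider "?q = 0" | "t = 0" | "y 0 = 0" "y 2 = 0" "t \<noteq> 0" by auto
  then show ?thesis
  proof cases
    case 3
    have "y x = 0" if "x < n" for x
    proof -
      consider "x = 0" | "x = 1" | "x = 2" | "x = 3" | "4 \<le> x" by linarith
      then show ?thesis using e1 e3 ej[of x] 3 that by cases auto
    qed
    then show ?thesis using ne by auto
  qed (unfold p, simp_all)
qed

lemma resolvent_energy_X_graph:
  assumes n: "4 \<le> n"
  shows "resolvent_energy (X_graph n) = X_energy n"
proof -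
  interpret pair_graph "X_graph n" using n by (intro X_graph_pair_graph) simp
  let ?S = "adj_eigenvalues (X_graph n)" and ?n = "real n"
  let ?d = "?n ^ 5 + (- ?n) * ?n ^ 3 + (- 2) * ?n ^ 2 + (?n - 3) * ?n"
  have d: "?d = ?n ^ 5 - ?n ^ 4 - ?n ^ 2 - 3 * ?n"
    by (simp add: algebra_simps power_numeral_reduce)
  have d0: "?d \<noteq> 0" unfolding d using X_denominator_pos[of ?n] n by simp
  have P: "real (size ?S) = ?n" "power_sum ?S 1 = 0" "power_sum ?S 2 = 2 * ?n" "power_sum ?S 3 = 6"
    "power_sum ?S 4 = 2 * ?n ^ 2 - 4 * ?n + 12"
    using n size_adj_eigenvalues[OF pair_graph] power_sums X_graph_moments[of n] X_graph_card_parcs[of n]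
    by auto
  have ev: "t ^ 5 + (- ?n) * t ^ 3 + (- 2) * t ^ 2 + (?n - 3) * t = 0" if "t \<in># ?S" for t
    using n that by (intro X_graph_eigenvalue) simp_all
  have "resolvent_energy (X_graph n) = (\<Sum>t\<in>#?S. 1 / (?n - t))"
    by (simp add: resolvent_energy_def)
  also have "\<dots> = ((?n ^ 4 + (- ?n) * ?n ^ 2 + (- 2) * ?n + (?n - 3)) * ?n
    + (?n ^ 3 + (- ?n) * ?n + (- 2)) * 0 + (?n ^ 2 + (- ?n)) * (2 * ?n)
    + ?n * 6 + (2 * ?n ^ 2 - 4 * ?n + 12)) / ?d"
    using resolvent_sum_of_roots[OF ev refl d0] by (simp only: P)
  also have "\<dots> = X_energy n"
    unfolding d X_energy_def by (rule arg_cong2[where f = "(/)"]) (simp_all add: algebra_simps power_numeral_reduce)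
  finally show ?thesis .
qed

lemma resolvent_energy_X_tilde_graph:
  assumes n: "4 \<le> n"
  shows "resolvent_energy (X_tilde_graph n) = X_tilde_energy n"
proof -
  interpret pair_graph "X_tilde_graph n" using n by (rule X_tilde_graph_pair_graph)
  let ?S = "adj_eigenvalues (X_tilde_graph n)" and ?n = "real n"
  let ?d = "?n ^ 5 + (- ?n) * ?n ^ 3 + 0 * ?n ^ 2 + (2 * ?n - 8) * ?n"
  have d: "?d = ?n ^ 5 - ?n ^ 4 + 2 * ?n ^ 2 - 8 * ?n"
    by (simp add: algebra_simps power_numeral_reduce)
  have d0: "?d \<noteq> 0" unfolding d using X_tilde_denominator_pos[of ?n] n by simp
  have P: "real (size ?S) = ?n" "power_sum ?S 1 = 0" "power_sum ?S 2 = 2 * ?n" "power_sum ?S 3 = 0"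
    "power_sum ?S 4 = 2 * ?n ^ 2 - 8 * ?n + 32"
    using n size_adj_eigenvalues[OF pair_graph] power_sums X_tilde_graph_moments[of n]
      X_tilde_graph_card_parcs[of n]
    by auto
  have ev: "t ^ 5 + (- ?n) * t ^ 3 + 0 * t ^ 2 + (2 * ?n - 8) * t = 0" if "t \<in># ?S" for t
    using n that by (intro X_tilde_graph_eigenvalue) simp_all
  have "resolvent_energy (X_tilde_graph n) = (\<Sum>t\<in>#?S. 1 / (?n - t))"
    by (simp add: resolvent_energy_def)
  also have "\<dots> = ((?n ^ 4 + (- ?n) * ?n ^ 2 + 0 * ?n + (2 * ?n - 8)) * ?n
    + (?n ^ 3 + (- ?n) * ?n + 0) * 0 + (?n ^ 2 + (- ?n)) * (2 * ?n)
    + ?n * 0 + (2 * ?n ^ 2 - 8 * ?n + 32)) / ?d"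
    using resolvent_sum_of_roots[OF ev refl d0] by (simp only: P)
  also have "\<dots> = X_tilde_energy n"
    unfolding d X_tilde_energy_def
    by (rule arg_cong2[where f = "(/)"]) (simp_all add: algebra_simps power_numeral_reduce)
  finally show ?thesis .
qed

lemma bij_extending_list:
  assumes "finite V" "distinct xs" "set xs \<subseteq> V"
  obtains f where "bij_betw f {..<card V} V" "\<forall>i<length xs. f i = xs ! i"
proof -
  let ?k = "length xs"
  have k: "card (set xs) = ?k" "?k \<le> card V"
    using assms by (auto simp: distinct_card card_mono simp flip: distinct_card)
  have "card {?k..<card V} = card (V - set xs)"
    using assms k by (simp add: card_Diff_subset)
  then obtain g where g: "bij_betw g {?k..<card V} (V - set xs)"
    using assms finite_same_card_bij[of "{?k..<card V}" "V - set xs"] by auto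
  define f where "f i = (if i < ?k then xs ! i else g i)" for i
  have "bij_betw f {..<?k} (set xs)"
    using bij_betw_nth[OF assms(2) refl refl] by (rule bij_betw_cong[THEN iffD1, rotated]) (simp add: f_def)
  moreover have "bij_betw f {?k..<card V} (V - set xs)"
    using g by (rule bij_betw_cong[THEN iffD1, rotated]) (simp add: f_def)
  ultimately have "bij_betw f ({..<?k} \<union> {?k..<card V}) (set xs \<union> (V - set xs))"
    by (rule bij_betw_combine) auto
  moreover have "{..<?k} \<union> {?k..<card V} = {..<card V}" using k by auto
  moreover have "set xs \<union> (V - set xs) = V" using assms by auto
  ultimately show ?thesis using that by (simp add: f_def)
qed

lemma digraph_iso_enumI:
  assumes G: "pair_graph G" and H: "pair_graph H" and n: "pverts H = {..<n}"
    and f: "bij_betw f {..<n} (pverts G)"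
    and E: "\<And>i j. i < n \<Longrightarrow> j < n \<Longrightarrow> (f i, f j) \<in> parcs G \<longleftrightarrow> (i, j) \<in> parcs H"
  shows "digraph_iso (with_proj G) (with_proj H)"
proof (rule digraph_isoI[OF G H])
  let ?h = "the_inv_into {..<n} f"
  show "bij_betw ?h (pverts G) (pverts H)" unfolding n by (rule bij_betw_the_inv_into[OF f])
  fix x y assume "x \<in> pverts G" "y \<in> pverts G"
  then have "x \<in> f ` {..<n}" "y \<in> f ` {..<n}" using f by (simp_all add: bij_betw_def)
  then obtain i j where ij: "i < n" "j < n" "x = f i" "y = f j" by auto
  have "?h (f k) = k" if "k < n" for k
    using f that by (simp add: bij_betw_def the_inv_into_f_f)
  then show "(x, y) \<in> parcs G \<longleftrightarrow> (?h x, ?h y) \<in> parcs H" using ij E by simp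
qed

section \<open>Comparison with the extremal graphs\<close>

context pair_graph
begin

lemma dominating_vertex_iso_X_graph:
  assumes uni: "unicyclic G" and c: "c \<in> pverts G" "sg.deg (pverts G) c + 1 = card (pverts G)"
    and n: "card (pverts G) = n"
  shows "digraph_iso (with_proj G) (with_proj (X_graph n))"
proof -
  let ?V = "pverts G"
  note U = unicyclic_imp_unicyclic_on[OF uni]
  have n3: "3 \<le> n" using sg.card_ge_3[OF U] n by simp
  obtain v w where s: "v \<in> ?V - {c}" "w \<in> ?V - {c}" "v \<noteq> w" "\<forall>y\<in>?V - {c}. (c, y) \<in> parcs G"
    "\<forall>x\<in>?V - {c}. \<forall>y\<in>?V - {c}. (x, y) \<in> parcs G \<longleftrightarrow> x = v \<and> y = w \<or> x = w \<and> y = v"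
    using sg.dominating_vertex_structure[OF U c] .
  have "distinct [c, v, w]" "set [c, v, w] \<subseteq> ?V" using s(1-3) c(1) by auto
  then obtain f where f: "bij_betw f {..<n} ?V" and fi: "\<forall>i<length [c, v, w]. f i = [c, v, w] ! i"
    using bij_extending_list[OF pair_finite_verts, unfolded n] by blast
  have f3: "f 0 = c" "f 1 = v" "f 2 = w" using fi[rule_format] by force+
  have inj: "f i = f j \<longleftrightarrow> i = j" if "i < n" "j < n" for i j
    using f that by (auto simp: bij_betw_def dest: inj_onD)
  have fV: "f i \<in> ?V" if "i < n" for i using f that by (auto simp: bij_betw_def)
  show ?thesis
  proof (rule digraph_iso_enumI[OF pair_graph X_graph_pair_graph[OF n3] _ f])
    fix i j assume ij: "i < n" "j < n"
    have idx: "f k = c \<longleftrightarrow> k = 0" "f k = v \<longleftrightarrow> k = 1" "f k = w \<longleftrightarrow> k = 2" if "k < n" for k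
      using inj[OF that, of 0] inj[OF that, of 1] inj[OF that, of 2] n3 f3 by auto
    consider "i = 0" | "j = 0" "i \<noteq> 0" | "i \<noteq> 0" "j \<noteq> 0" by auto
    then show "(f i, f j) \<in> parcs G \<longleftrightarrow> (i, j) \<in> parcs (X_graph n)"
    proof cases
      case 1
      then have "(f i, f j) \<in> parcs G \<longleftrightarrow> f j \<noteq> c"
        using s(4) fV[OF ij(2)] f3 sg.adj_irrefl by auto
      then show ?thesis using 1 ij idx[OF ij(2)] n3 by (auto simp: parcs_X_graph)
    next
      case 2
      then have "(f i, f j) \<in> parcs G"
        using s(4) fV[OF ij(1)] f3 idx[OF ij(1)] by (auto intro: sg.adj_sym)
      then show ?thesis using 2 ij n3 by (auto simp: parcs_X_graph)
    next
      case 3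
      then have "(f i, f j) \<in> parcs G \<longleftrightarrow> i = 1 \<and> j = 2 \<or> i = 2 \<and> j = 1"
        using s(5) fV ij idx by auto
      then show ?thesis using 3 ij n3 by (auto simp: parcs_X_graph)
    qed
  qed simp
qed

lemma almost_dominating_vertex_iso_X_tilde_graph:
  assumes uni: "unicyclic G" and tf: "sg.triangle_free (pverts G)"
    and c: "c \<in> pverts G" "sg.deg (pverts G) c + 2 = card (pverts G)" and n: "card (pverts G) = n"
  shows "digraph_iso (with_proj G) (with_proj (X_tilde_graph n))"
proof -
  let ?V = "pverts G"
  note U = unicyclic_imp_unicyclic_on[OF uni]
  have n4: "4 \<le> n" using sg.triangle_free_card[OF U tf] n by simp
  obtain w p q where s: "w \<in> ?V - {c}" "(c, w) \<notin> parcs G" "p \<in> ?V - {c, w}" "q \<in> ?V - {c, w}"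
    "p \<noteq> q" "\<forall>y\<in>?V - {c, w}. (c, y) \<in> parcs G"
    "\<forall>x\<in>?V - {c}. \<forall>y\<in>?V - {c}.
       (x, y) \<in> parcs G \<longleftrightarrow> x = w \<and> (y = p \<or> y = q) \<or> y = w \<and> (x = p \<or> x = q)"
    using sg.almost_dominating_vertex_structure[OF U tf c] .
  \<comment> \<open>The list runs around the 4-cycle, so \<open>w\<close>, opposite to
    \<open>c\<close>, receives the label 2.\<close>
  have "distinct [c, p, w, q]" "set [c, p, w, q] \<subseteq> ?V" using s(1,3,4,5) c(1) by auto
  then obtain f where f: "bij_betw f {..<n} ?V"
    and fi: "\<forall>i<length [c, p, w, q]. f i = [c, p, w, q] ! i"
    using bij_extending_list[OF pair_finite_verts, unfolded n] by blast
  have f4: "f 0 = c" "f 1 = p" "f 2 = w" "f 3 = q" using fi[rule_format] by force+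
  have inj: "f i = f j \<longleftrightarrow> i = j" if "i < n" "j < n" for i j
    using f that by (auto simp: bij_betw_def dest: inj_onD)
  have fV: "f i \<in> ?V" if "i < n" for i using f that by (auto simp: bij_betw_def)
  have idx: "f k = c \<longleftrightarrow> k = 0" "f k = p \<longleftrightarrow> k = 1" "f k = w \<longleftrightarrow> k = 2" "f k = q \<longleftrightarrow> k = 3" if "k < n" for k
    using inj[OF that, of 0] inj[OF that, of 1] inj[OF that, of 2] inj[OF that, of 3] n4 f4 by auto
  have cE: "(c, f k) \<in> parcs G \<longleftrightarrow> k \<noteq> 0 \<and> k \<noteq> 2" if "k < n" for k
    using s(2,6) fV[OF that] idx[OF that] sg.adj_irrefl[of c] f4 by (cases "k = 0 \<or> k = 2") auto
  show ?thesis
  proof (rule digraph_iso_enumI[OF pair_graph X_tilde_graph_pair_graph[OF n4] _ f])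
    fix i j assume ij: "i < n" "j < n"
    consider "i = 0" | "j = 0" "i \<noteq> 0" | "i \<noteq> 0" "j \<noteq> 0" by auto
    then show "(f i, f j) \<in> parcs G \<longleftrightarrow> (i, j) \<in> parcs (X_tilde_graph n)"
    proof cases
      case 1
      then show ?thesis using cE[OF ij(2)] f4 ij n4 by (auto simp: parcs_X_tilde_graph)
    next
      case 2
      have "(f i, c) \<in> parcs G \<longleftrightarrow> (c, f i) \<in> parcs G" using sg.adj_sym by blast
      then show ?thesis using 2 cE[OF ij(1)] f4 ij n4 by (auto simp: parcs_X_tilde_graph)
    next
      case 3
      then have "(f i, f j) \<in> parcs G \<longleftrightarrow> i = 2 \<and> (j = 1 \<or> j = 3) \<or> j = 2 \<and> (i = 1 \<or> i = 3)"
        using s(7) fV ij idx by auto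
      then show ?thesis using 3 ij n4 by (auto simp: parcs_X_tilde_graph)
    qed
  qed simp
qed

lemma unicyclic_power_sums:
  assumes uni: "unicyclic G"
  shows "real (size (adj_eigenvalues G)) = card (pverts G)"
    "power_sum (adj_eigenvalues G) 1 = 0"
    "power_sum (adj_eigenvalues G) 2 = 2 * real (card (pverts G))"
    "power_sum (adj_eigenvalues G) 5 \<le> 10 * real (card (pverts G))"
  using uni size_adj_eigenvalues[OF pair_graph] power_sums
    sg.unicyclic_mom5[OF unicyclic_imp_unicyclic_on[OF uni]] card_parcs
  by (auto simp: unicyclic_def)

lemma eigenvalue_square_bound:
  assumes "unicyclic G" "t \<in># adj_eigenvalues G"
  shows "(t\<^sup>2 - 1)\<^sup>2 \<le> sg.mom4 (pverts G) - 3 * card (pverts G)"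
  using shifted_square_le_power_sums[OF assms(2)] unicyclic_power_sums[OF assms(1)] power_sums(4)
  by simp

text \<open>A bound of this shape with \<open>K > 0\<close> also keeps the spectrum strictly below
  \<open>n\<close>: it forces \<open>t \<le> n\<close>, and \<open>t = n\<close> would give
  \<open>t\<^sup>2 \<le> 0\<close>.\<close>

lemma resolvent_energy_le:
  assumes uni: "unicyclic G"
    and K: "\<And>t. t \<in># adj_eigenvalues G \<Longrightarrow> t\<^sup>2 \<le> K * (real (card (pverts G)) - t)" and K0: "0 < K"
  defines "n \<equiv> real (card (pverts G))"
  shows "resolvent_energy G \<le> 1 + 2 / n ^ 2 + sg.mom3 (pverts G) / n ^ 4
    + (1 / n ^ 5 + K / n ^ 6) * sg.mom4 (pverts G) + 10 * n / n ^ 6"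
proof -
  note P = unicyclic_power_sums(1,2,3)[OF uni, folded n_def] power_sums(3,4,5)
  have n: "0 < n"
    using sg.card_ge_3[OF unicyclic_imp_unicyclic_on[OF uni]] by (simp add: n_def)
  have "t < n \<and> t\<^sup>2 \<le> K * (n - t)" if "t \<in># adj_eigenvalues G" for t
  proof -
    have le: "t\<^sup>2 \<le> K * (n - t)" using K[OF that] by (simp add: n_def)
    then have "0 \<le> K * (n - t)" using zero_le_power2[of t] by linarith
    then have "t \<le> n" using K0 by (simp add: zero_le_mult_iff)
    moreover have "t \<noteq> n" using le n by auto
    ultimately show ?thesis using le by simp
  qed
  then have "(\<Sum>t\<in>#adj_eigenvalues G. 1 / (n - t)) \<le>
    n / n + 0 / n ^ 2 + 2 * n / n ^ 3 + sg.mom3 (pverts G) / n ^ 4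
      + (1 / n ^ 5 + K / n ^ 6) * sg.mom4 (pverts G) + sg.mom5 (pverts G) / n ^ 6"
    using resolvent_sum_le[OF n, of "adj_eigenvalues G" K] unfolding P by blast
  moreover have "sg.mom5 (pverts G) / n ^ 6 \<le> 10 * n / n ^ 6"
    using unicyclic_power_sums(4)[OF uni] power_sums(5) n
    by (intro divide_right_mono) (auto simp: n_def)
  moreover have "n / n = 1" "2 * n / n ^ 3 = 2 / n ^ 2" using n by (auto simp: power_numeral_reduce)
  ultimately show ?thesis by (simp add: resolvent_energy_def n_def)
qed

text \<open>A graph with a triangle relies on the fourth-moment gap alone and needs the sharper
  \<open>K = 9 / 4\<close>, available from order 5 on. A triangle-free one also lacks the 6 in the
  third moment and affords \<open>K = 7 / 2\<close>, valid from order 4 on.\<close>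

lemma resolvent_energy_less_X_energy:
  assumes uni: "unicyclic G" and n4: "4 \<le> card (pverts G)"
    and nd: "\<And>c. c \<in> pverts G \<Longrightarrow> sg.deg (pverts G) c + 1 \<noteq> card (pverts G)"
  shows "resolvent_energy G < X_energy (card (pverts G))"
proof (cases "sg.triangle_free (pverts G)")
  case True
  let ?n = "real (card (pverts G))"
  note U = unicyclic_imp_unicyclic_on[OF uni]
  have m3: "sg.mom3 (pverts G) = 0" using True by (rule sg.triangle_free_mom3)
  have m4: "sg.mom4 (pverts G) \<le> 2 * ?n\<^sup>2 - 8 * ?n + 32"
    using sg.triangle_free_mom4[OF U True] by simp
  have "t\<^sup>2 \<le> 7 / 2 * (?n - t)" if "t \<in># adj_eigenvalues G" for t
    using eigenvalue_square_bound[OF uni that] m4 n4 by (intro spectral_bound_triangle_free) auto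
  from resolvent_energy_le[OF uni this] triangle_free_bound_less_X_energy[OF _ m4] n4 m3
  show ?thesis by simp
next
  case False
  let ?n = "real (card (pverts G))"
  note U = unicyclic_imp_unicyclic_on[OF uni]
  have n5: "5 \<le> card (pverts G)" using sg.not_dominated_card[OF U False nd] .
  have "sg.mom3 (pverts G) \<noteq> 0" using sg.mom3_eq_0_triangle_free[OF pair_finite_verts] False by blast
  then have m3: "sg.mom3 (pverts G) = 6" using sg.unicyclic_mom3_walk3[OF U] by auto
  have m4: "sg.mom4 (pverts G) \<le> 2 * ?n\<^sup>2 - 8 * ?n + 28"
    using sg.not_dominated_mom4[OF U False nd] by simp
  have "t\<^sup>2 \<le> 9 / 4 * (?n - t)" if "t \<in># adj_eigenvalues G" for t
    using eigenvalue_square_bound[OF uni that] m4 n5 by (intro spectral_bound_triangle) auto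
  from resolvent_energy_le[OF uni this] triangle_bound_less_X_energy[OF _ m4] n5 m3
  show ?thesis by simp
qed

lemma bipartite_triangle_free:
  assumes "bipartite G"
  shows "sg.triangle_free (pverts G)"
  using assms unfolding bipartite_def sg.triangle_free_def by blast

text \<open>The comparison graph is itself triangle-free, so the third moment gives no advantage and
  the fourth-moment gap must suffice; symmetry of the spectrum removes the odd powers from the
  estimate.\<close>

lemma bipartite_resolvent_energy_less_X_tilde_energy:
  assumes uni: "unicyclic G" and bip: "bipartite G"
    and nd: "\<And>c. c \<in> pverts G \<Longrightarrow> sg.deg (pverts G) c + 2 \<noteq> card (pverts G)"
  shows "resolvent_energy G < X_tilde_energy (card (pverts G))"
proof -
  let ?n = "real (card (pverts G))" and ?S = "adj_eigenvalues G"
  note U = unicyclic_imp_unicyclic_on[OF uni] and tf = bipartite_triangle_free[OF bip]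
  obtain A B where AB: "pverts G = A \<union> B" "A \<inter> B = {}" "parcs G \<subseteq> A \<times> B \<union> B \<times> A"
    using bip by (auto simp: bipartite_def)
  have n6: "6 \<le> card (pverts G)"
    using AB by (intro sg.bipartite_not_almost_dominated_card[OF U tf nd AB(1,2)]) auto
  have m4: "sg.mom4 (pverts G) \<le> 2 * ?n\<^sup>2 - 12 * ?n + 52"
    using sg.not_almost_dominated_mom4[OF U tf nd] by simp
  note P = unicyclic_power_sums(1,3)[OF uni] power_sums(4)
  have "t\<^sup>2 < ?n\<^sup>2 \<and> t\<^sup>2 \<le> 3 / (2 * ?n) * (?n\<^sup>2 - t\<^sup>2)" if "t \<in># ?S" for t
    using eigenvalue_square_bound[OF uni that] m4 n6 by (intro spectral_bound_bipartite) auto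
  then have "(\<Sum>t\<in>#?S. 1 / (?n - t)) \<le>
      ?n / ?n + 2 * ?n / ?n ^ 3 + (1 + 3 / (2 * ?n)) / ?n ^ 5 * sg.mom4 (pverts G)"
    using resolvent_sum_symmetric_le[of ?n ?S "3 / (2 * ?n)", OF _ bipartite_symmetric_spectrum[OF bip]]
      n6 unfolding P by force
  moreover have "?n / ?n = 1" "2 * ?n / ?n ^ 3 = 2 / ?n ^ 2"
    using n6 by (auto simp: power_numeral_reduce)
  ultimately show ?thesis
    using bipartite_bound_less_X_tilde_energy[OF _ m4] n6 by (simp add: resolvent_energy_def)
qed

end

theorem theorem3:
  fixes G :: "'a pair_pre_digraph" and n :: nat
  assumes "n \<ge> 4" and "unicyclic G" and "card (pverts G) = n"
  shows "resolvent_energy G \<le> resolvent_energy (X_graph n) \<and>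
    (resolvent_energy G = resolvent_energy (X_graph n) \<longleftrightarrow>
       digraph_iso (with_proj G) (with_proj (X_graph n))) \<and>
    (bipartite G \<longrightarrow>
       resolvent_energy G \<le> resolvent_energy (X_tilde_graph n) \<and>
       (resolvent_energy G = resolvent_energy (X_tilde_graph n) \<longleftrightarrow>
          digraph_iso (with_proj G) (with_proj (X_tilde_graph n))))"
proof -
  have pg: "pair_graph G" using assms by (simp add: unicyclic_def)
  interpret pair_graph G by (rule pg)
  have X: "pair_graph (X_graph n)" and Xt: "pair_graph (X_tilde_graph n)"
    using assms by (auto intro: X_graph_pair_graph X_tilde_graph_pair_graph)
  \<comment> \<open>This alternative settles both the bound and the equality case: a dominating
    vertex gives the isomorphism, its absence a strict inequality.\<close>
  have "digraph_iso (with_proj G) (with_proj (X_graph n)) \<or>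
      resolvent_energy G < resolvent_energy (X_graph n)"
    using dominating_vertex_iso_X_graph[OF assms(2) _ _ assms(3)]
      resolvent_energy_less_X_energy[OF assms(2)] resolvent_energy_X_graph[OF assms(1)] assms(1,3)
    by metis
  then have 1: "resolvent_energy G \<le> resolvent_energy (X_graph n) \<and>
    (resolvent_energy G = resolvent_energy (X_graph n) \<longleftrightarrow>
       digraph_iso (with_proj G) (with_proj (X_graph n)))"
    using resolvent_energy_iso[OF pg X] by auto
  have "digraph_iso (with_proj G) (with_proj (X_tilde_graph n)) \<or>
      resolvent_energy G < resolvent_energy (X_tilde_graph n)" if "bipartite G"
    using almost_dominating_vertex_iso_X_tilde_graph[OF assms(2) bipartite_triangle_free[OF that] _ _ assms(3)]
      bipartite_resolvent_energy_less_X_tilde_energy[OF assms(2) that]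
      resolvent_energy_X_tilde_graph[OF assms(1)] assms(3)
    by metis
  then have "bipartite G \<longrightarrow> resolvent_energy G \<le> resolvent_energy (X_tilde_graph n) \<and>
       (resolvent_energy G = resolvent_energy (X_tilde_graph n) \<longleftrightarrow>
          digraph_iso (with_proj G) (with_proj (X_tilde_graph n)))"
    using resolvent_energy_iso[OF pg Xt] by auto
  with 1 show ?thesis by blast
qed

end
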